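(* Let $\Delta_1,\Delta_2,\ldots$ be i.i.d. positive random variables such that $P(\Delta_1\ge x)=x^{-1}\ell(x)$ for all $x\ge1$, where $\ell$ is slowly varying at infinity, and assume $\mathbb{E}(\Delta_1)=\infty$. Let $T_n=\Delta_1+\cdots+\Delta_n$. Then, as $n\to\infty$, $$\mathbb{E}\left[\left(\frac{T_n}{b_n}\,\frac{\ell(b_n)}{\ell^*(b_n)}\right)^{-1}\right]\longrightarrow 1.$$ In particular, taking continuous $\Delta_j$ with support $[1,\infty)$ and $P(\Delta_j>x)=1/x$ for $x>1$ (so that $\ell(n)=1$, $b_n=n$, $\ell^*(n)=\ln n$, and $T_n$ has the same distribution as $\frac{1}{U_1}+\cdots+\frac{1}{U_n}$), one retrieves the known fact that if $U_1,\ldots,U_n$ are i.i.d. uniform on $(0,1)$, then $$(\ln n)\,\mathbb{E}\left(\frac{n}{\frac{1}{U_1}+\cdots+\frac{1}{U_n}}\right)\longrightarrow 1.$$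
   Context: $F$ is the distribution function of $\Delta_1$. For each positive integer $n$, $b_n$ is the quantile of order $1-1/n$ of $F$, i.e. $\frac{1}{1-F(b_n)}=n$. The function $\ell^*$ is defined by $\ell^*(x)=\int_1^x\frac{\ell(u)}{u}\,du$.
   Formalization: The formal theorem also assumes E(1/T_m) finite for some m ≥ 1; positivity alone leaves the law near 0 free, so E(1/T_n) can be infinite for all n. The condition follows from Δ ≥ 1 and is necessary for the conclusion. b_n may be any quantile of order 1-1/n. *)

theory Defs
  imports "HOL-Probability.Probability"
begin

(* Sequences of random variables are indexed from 1; the value at index 0 plays no role. *)

definition iid_seq :: "'a measure \<Rightarrow> (nat \<Rightarrow> 'a \<Rightarrow> real) \<Rightarrow> bool" where
  "iid_seq M X \<longleftrightarrow>
     prob_space.indep_vars M (\<lambda>_. borel) X {1..} \<and>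
     (\<forall>i\<ge>1. distr M borel (X i) = distr M borel (X 1))"

definition partial_sum :: "(nat \<Rightarrow> 'a \<Rightarrow> real) \<Rightarrow> nat \<Rightarrow> 'a \<Rightarrow> real" where
  "partial_sum X n \<omega> = (\<Sum>i=1..n. X i \<omega>)"

(* Only the germ of L at infinity matters, as usual for regular variation. *)
definition slowly_varying :: "(real \<Rightarrow> real) \<Rightarrow> bool" where
  "slowly_varying L \<longleftrightarrow>
     (\<exists>a. set_borel_measurable borel {a..} L \<and> (\<forall>x\<ge>a. L x > 0)) \<and>
     (\<forall>c>0. ((\<lambda>x. L (c * x) / L x) \<longlongrightarrow> 1) at_top)"

definition ell_star :: "(real \<Rightarrow> real) \<Rightarrow> real \<Rightarrow> real" where
  "ell_star L x = (LBINT u=ereal 1..ereal x. L u / u)"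

(* A quantile of order p of the law D: D(-oo,x) <= p <= F(x), with F the distribution function.
   If F has jumps, 1 / (1 - F(x)) = n need not be solvable. The lemmas below show that every
   solution of this equation, and the generalised inverse of F at 1 - 1/n, are quantiles of
   order 1 - 1/n in this sense. *)
definition is_quantile :: "real measure \<Rightarrow> real \<Rightarrow> real \<Rightarrow> bool" where
  "is_quantile D p x \<longleftrightarrow> measure D {..<x} \<le> p \<and> p \<le> cdf D x"

lemma is_quantile_if_tail_eq:
  assumes "real_distribution D" and "n \<ge> 1" and "1 / (1 - cdf D x) = real n"
  shows "is_quantile D (1 - 1 / real n) x"
proof -
  interpret real_distribution D by fact
  have "1 - cdf D x = 1 / real n"
    using assms(2,3) by (metis div_by_1 divide_divide_eq_right mult_1)
  then have eq: "cdf D x = 1 - 1 / real n" by linarith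
  have "measure D {..<x} \<le> measure D {..x}"
    by (rule finite_measure_mono) auto
  with eq show ?thesis by (simp add: is_quantile_def cdf_def)
qed

lemma is_quantile_generalised_inverse:
  assumes "real_distribution D" and p: "0 < p" "p < 1"
  shows "is_quantile D p (Inf {x. p \<le> cdf D x})"
proof -
  interpret real_distribution D by fact
  let ?S = "{x. p \<le> cdf D x}"
  let ?q = "Inf ?S"
  have "eventually (\<lambda>x. p < cdf D x) at_top"
    using order_tendstoD(1)[OF cdf_lim_at_top_prob p(2)] .
  then obtain x0 where x0: "p < cdf D x0"
    using eventually_happens trivial_limit_at_top_linorder by blast
  have "eventually (\<lambda>x. cdf D x < p) at_bot"
    using order_tendstoD(2)[OF cdf_lim_at_bot p(1)] .
  then obtain y0 where y0: "cdf D y0 < p"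
    using eventually_happens trivial_limit_at_bot_linorder by blast
  have bdd: "bdd_below ?S"
  proof (rule bdd_belowI)
    fix x assume "x \<in> ?S"
    then show "y0 \<le> x"
      using y0 cdf_nondecreasing[of x y0] by (cases "x \<le> y0") auto
  qed
  have ne: "?S \<noteq> {}" using x0 less_imp_le by blast
  have below: "cdf D x < p" if "x < ?q" for x
    using that cInf_lower[OF _ bdd, of x] by force
  have above: "p \<le> cdf D x" if "?q < x" for x
  proof -
    obtain s where "s \<in> ?S" "s < x" using cInf_lessD[OF ne \<open>?q < x\<close>] by blast
    then show ?thesis using cdf_nondecreasing[of s x] by auto
  qed
  have "measure D {..<?q} \<le> p"
  proof (rule tendsto_upperbound[OF cdf_at_left])
    show "eventually (\<lambda>x. cdf D x \<le> p) (at_left ?q)"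
      using below by (auto simp: eventually_at_filter less_imp_le)
  qed simp
  moreover have "p \<le> cdf D ?q"
  proof (rule tendsto_lowerbound)
    show "(cdf D \<longlongrightarrow> cdf D ?q) (at_right ?q)"
      using cdf_is_right_cont[of ?q] by (simp add: continuous_within)
    show "eventually (\<lambda>x. p \<le> cdf D x) (at_right ?q)"
      using above by (auto simp: eventually_at_filter)
  qed simp
  ultimately show ?thesis by (simp add: is_quantile_def)
qed

(* Positivity of X together with a condition on P(X 1 >= x) for x >= 1 does not control the law
   near 0, and E(1 / T_n) may be infinite for every n, e.g. if P(X 1 < e) = 1 / (2 * ln (1 / e))
   for small e. The condition below excludes exactly this: it holds if X >= 1 almost surely, and
   it follows from convergence to 1 of expectations of 1 / (c_n * T_n), whatever the constants. *)
definition finite_inverse_moment :: "'a measure \<Rightarrow> (nat \<Rightarrow> 'a \<Rightarrow> real) \<Rightarrow> bool" where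
  "finite_inverse_moment M X \<longleftrightarrow> (\<exists>m\<ge>1. integrable M (\<lambda>\<omega>. inverse (partial_sum X m \<omega>)))"

lemma finite_inverse_moment_if_ge_1:
  assumes "prob_space M" and "X 1 \<in> borel_measurable M" and "AE \<omega> in M. X 1 \<omega> \<ge> 1"
  shows "finite_inverse_moment M X"
proof -
  interpret prob_space M by fact
  have "integrable M (\<lambda>\<omega>. inverse (X 1 \<omega>))"
  proof (rule integrable_const_bound[where B=1])
    show "AE \<omega> in M. norm (inverse (X 1 \<omega>)) \<le> 1"
      using assms(3) by eventually_elim (simp add: inverse_le_1_iff)
  qed (use assms(2) in measurable)
  then show ?thesis
    unfolding finite_inverse_moment_def by (intro exI[of _ 1]) (simp add: partial_sum_def)
qed

lemma finite_inverse_moment_necessary: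
  assumes "(\<lambda>n. integral\<^sup>L M (\<lambda>\<omega>. inverse (c n * partial_sum X n \<omega>))) \<longlonglongrightarrow> 1"
  shows "finite_inverse_moment M X"
proof -
  have "eventually (\<lambda>n. integral\<^sup>L M (\<lambda>\<omega>. inverse (c n * partial_sum X n \<omega>)) > 0) sequentially"
    using order_tendstoD(1)[OF assms, of 0] by simp
  then obtain n where n: "n \<ge> 1"
      and pos: "integral\<^sup>L M (\<lambda>\<omega>. inverse (c n * partial_sum X n \<omega>)) > 0"
    unfolding eventually_sequentially by (metis nat_le_linear)
  have int: "integrable M (\<lambda>\<omega>. inverse (c n * partial_sum X n \<omega>))"
    using pos not_integrable_integral_eq by fastforce
  have "c n \<noteq> 0" using pos by auto
  then have "(\<lambda>\<omega>. inverse (partial_sum X n \<omega>)) = (\<lambda>\<omega>. c n * inverse (c n * partial_sum X n \<omega>))"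
    by (simp add: fun_eq_iff)
  with int have "integrable M (\<lambda>\<omega>. inverse (partial_sum X n \<omega>))" by simp
  with n show ?thesis by (auto simp: finite_inverse_moment_def)
qed

end

theory Submission
  imports Defs
begin

text \<open>
  Let \<open>T n\<close> be the partial sums and \<open>\<phi>\<close> the Laplace transform of the law of the summands. Since
  \<open>1 / T = \<integral> exp (- t T) dt\<close> over \<open>t > 0\<close>, independence gives
  \<open>E (a / T n) = \<integral> \<phi> (s / a) ^ n ds\<close> for every \<open>a > 0\<close>. With \<open>H y = E (min X y)\<close> one has
  \<open>1 - \<phi> t ~ t * H (1 / t)\<close> as \<open>t \<rightarrow> 0\<close>, and \<open>H = ell_star L + const\<close> is slowly varying. For the
  normalisation \<open>a n = b n * ell_star L (b n) / L (b n)\<close> this yields \<open>n * (1 - \<phi> (s / a n)) \<rightarrow> s\<close>, so the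
  integrand tends to \<open>exp (- s)\<close>. A Potter bound dominates it for \<open>s \<le> r * a n\<close>; beyond that range it
  is at most \<open>\<phi> r ^ (n - m) * \<phi> (s / a n) ^ m\<close>, which is negligible because \<open>E (1 / T m)\<close> is finite
  and \<open>a n\<close> grows at most quadratically.
\<close>

section \<open>Integrated tails of index zero\<close>

text \<open>Two obstacles shape the proof. The ratio
  \<open>a n / b n = ell_star L (b n) / L (b n)\<close> is unbounded, so comparing
  \<open>H (a n)\<close> with \<open>H (b n)\<close> is not a question about a fixed dilation; and
  the integrand has to be dominated for \<open>s\<close> ranging up to a multiple of
  \<open>a n\<close>. One estimate settles both:
  \<open>H (z * y) - H y <= 8 * (y * G y) * sqrt z\<close> for \<open>z >= 1\<close> and large
  \<open>y\<close>. The exponent 1/2 is a choice from (0, 1). Being below 1, it makes the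
  normalisation error of order \<open>1 / sqrt z\<close>, because
  \<open>z * (y * G y) = H y - h\<close> there, and it keeps
  \<open>n * (1 - \<phi> (s / a n))\<close> above a multiple of \<open>sqrt s\<close>. Its value 1/2
  also gives \<open>H y = O(sqrt y)\<close>, which is the source of the quadratic growth of
  \<open>a n\<close>. The tail \<open>G\<close> may jump, so \<open>H\<close> need not be
  differentiable. The locale therefore expresses that \<open>H\<close> is an integral of
  \<open>G\<close> only through two-sided bounds on increments, and index zero means that
  \<open>x * G x\<close> varies slowly.\<close>

locale integrated_tail =
  fixes H G :: "real \<Rightarrow> real"
  assumes increment_lower: "0 < x \<Longrightarrow> x \<le> y \<Longrightarrow> (y - x) * G y \<le> H y - H x"
    and increment_upper: "0 < x \<Longrightarrow> x \<le> y \<Longrightarrow> H y - H x \<le> (y - x) * G x"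
    and G_pos: "0 < x \<Longrightarrow> 0 < G x"
    and H_pos: "0 < x \<Longrightarrow> 0 < H x"
    and H_at_top: "filterlim H at_top at_top"
    and slow: "0 < c \<Longrightarrow> ((\<lambda>x. (c * x * G (c * x)) / (x * G x)) \<longlongrightarrow> 1) at_top"
begin

section \<open>Karamata-type asymptotics of the integrated tail\<close>

lemma H_mono: "0 < x \<Longrightarrow> x \<le> y \<Longrightarrow> H x \<le> H y"
  using increment_lower[of x y] G_pos[of y] mult_nonneg_nonneg[of "y - x" "G y"] by linarith

text \<open>Halving \<open>x\<close> repeatedly cuts off dyadic blocks, each of which adds about
  \<open>x * G x / 2\<close> to \<open>H x\<close>, since \<open>y * G y\<close> varies slowly. The
  number of blocks is arbitrary, so \<open>x * G x\<close> is negligible against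
  \<open>H x\<close>.\<close>

lemma ratio_at_top: "filterlim (\<lambda>x. H x / (x * G x)) at_top at_top"
  unfolding filterlim_at_top
proof
  fix Z :: real
  \<comment> \<open>The \<open>k\<close> quotients have limit sum \<open>k\<close>, so their sum
    eventually exceeds \<open>k - 1\<close>; the factor 1/2 per block leaves
    \<open>(k - 1) / 2\<close>, which must exceed \<open>Z\<close>.\<close>
  obtain k :: nat where k: "2 * Z + 1 < real k" using reals_Archimedean2 by blast
  define p where "p j x = (1/2)^j * x" for j and x :: real
  have "((\<lambda>x. \<Sum>j<k. (p j x * G (p j x)) / (x * G x)) \<longlongrightarrow> (\<Sum>j<k. 1)) at_top"
    unfolding p_def by (intro tendsto_sum slow) simp
  then have "eventually (\<lambda>x. real k - 1 < (\<Sum>j<k. (p j x * G (p j x)) / (x * G x))) at_top"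
    by (rule order_tendstoD(1)) simp
  moreover have "eventually (\<lambda>x::real. 0 < x) at_top" by (rule eventually_gt_at_top)
  ultimately show "eventually (\<lambda>x. Z \<le> H x / (x * G x)) at_top"
  proof eventually_elim
    fix x :: real assume s: "real k - 1 < (\<Sum>j<k. (p j x * G (p j x)) / (x * G x))" and x: "0 < x"
    have ppos: "0 < p j x" for j using x by (simp add: p_def)
    have "(\<Sum>j<k. (p j x * G (p j x)) / 2) \<le> (\<Sum>j<k. H (p j x) - H (p (Suc j) x))"
    proof (rule sum_mono)
      fix j
      have "p j x - p (Suc j) x = p j x / 2" by (simp add: p_def)
      moreover have "p (Suc j) x \<le> p j x" using x by (simp add: p_def)
      ultimately show "(p j x * G (p j x)) / 2 \<le> H (p j x) - H (p (Suc j) x)"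
        using increment_lower[OF ppos[of "Suc j"], of "p j x"] by simp
    qed
    also have "\<dots> = H (p 0 x) - H (p k x)" by (rule sum_lessThan_telescope')
    also have "\<dots> \<le> H x" using H_pos[OF ppos, of k] by (simp add: p_def)
    finally have *: "(\<Sum>j<k. p j x * G (p j x)) / 2 \<le> H x" by (simp add: sum_divide_distrib)
    have xG: "0 < x * G x" using x G_pos[OF x] by simp
    have "(real k - 1) / 2 < (\<Sum>j<k. (p j x * G (p j x)) / (x * G x)) / 2" using s by simp
    also have "\<dots> = (\<Sum>j<k. p j x * G (p j x)) / 2 / (x * G x)"
      by (simp add: sum_divide_distrib mult_ac)
    also have "\<dots> \<le> H x / (x * G x)" using * xG by (intro divide_right_mono) auto
    finally have "(real k - 1) / 2 < H x / (x * G x)" .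
    moreover have "Z < (real k - 1) / 2" using k by simp
    ultimately show "Z \<le> H x / (x * G x)" by (meson less_imp_le less_trans)
  qed
qed

text \<open>For \<open>c >= 1\<close> the increment is at most \<open>(c - 1) * x * G x\<close>,
  negligible by \<open>ratio_at_top\<close>. For \<open>c < 1\<close> the dilation
  \<open>1 / c\<close> is applied at the point \<open>c * x\<close> and the quotient
  inverted.\<close>

lemma H_slow:
  assumes c: "0 < c" shows "((\<lambda>x. H (c * x) / H x) \<longlongrightarrow> 1) at_top"
proof -
  have ge1: "((\<lambda>x. H (c * x) / H x) \<longlongrightarrow> 1) at_top" if c: "1 \<le> c" for c
  proof (rule real_tendsto_sandwich)
    show "((\<lambda>x::real. 1::real) \<longlongrightarrow> 1) at_top" by simp
    have "((\<lambda>x. 1 + (c - 1) * inverse (H x / (x * G x))) \<longlongrightarrow> 1 + (c - 1) * 0) at_top"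
      by (intro tendsto_intros tendsto_inverse_0_at_top ratio_at_top)
    then show "((\<lambda>x. 1 + (c - 1) * inverse (H x / (x * G x))) \<longlongrightarrow> 1) at_top" by simp
    show "eventually (\<lambda>x. 1 \<le> H (c * x) / H x) at_top"
      using eventually_gt_at_top[of 0]
    proof eventually_elim
      case (elim x)
      then show ?case using H_mono[of x "c * x"] H_pos[of x] c by simp
    qed
    show "eventually (\<lambda>x. H (c * x) / H x \<le> 1 + (c - 1) * inverse (H x / (x * G x))) at_top"
      using eventually_gt_at_top[of 0]
    proof eventually_elim
      case (elim x)
      then have "H (c * x) - H x \<le> (c * x - x) * G x" using increment_upper[of x "c * x"] c by simp
      then show ?case using H_pos[OF elim] by (simp add: field_simps)
    qed
  qed
  show ?thesis
  proof (cases "1 \<le> c")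
    case False
    have "filterlim (\<lambda>x. c * x) at_top at_top"
      using c by (intro filterlim_tendsto_pos_mult_at_top[OF tendsto_const] filterlim_ident)
    then have "((\<lambda>x. H ((1/c) * (c * x)) / H (c * x)) \<longlongrightarrow> 1) at_top"
      using False c by (intro filterlim_compose[OF ge1]) auto
    then have "((\<lambda>x. inverse (H ((1/c) * (c * x)) / H (c * x))) \<longlongrightarrow> inverse 1) at_top"
      by (rule tendsto_inverse) simp
    then show ?thesis using c by simp
  qed (rule ge1)
qed

text \<open>A Potter-type bound for the slowly varying function \<open>y * G y\<close>, summed over dyadic blocks.\<close>

lemma increment_sqrt_bound:
  "\<exists>y0>0. \<forall>y\<ge>y0. \<forall>z\<ge>1. H (z * y) - H y \<le> 8 * (y * G y) * sqrt z"
proof -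
  \<comment> \<open>Slow variation allows any factor above 1 per doubling; with
    \<open>sqrt 2\<close>, a chain of \<open>k\<close> doublings costs
    \<open>sqrt (2^k)\<close>.\<close>
  have "eventually (\<lambda>x. (2 * x * G (2 * x)) / (x * G x) < sqrt 2) at_top"
    by (rule order_tendstoD(2)[OF slow]) auto
  then obtain y1 where y1: "\<And>y. y1 \<le> y \<Longrightarrow> (2 * y * G (2 * y)) / (y * G y) < sqrt 2"
    unfolding eventually_at_top_linorder by blast
  define y0 where "y0 = max y1 1"
  have dbl: "2 * y * G (2 * y) \<le> sqrt 2 * (y * G y)" if "y0 \<le> y" for y
  proof -
    have "0 < y" using that by (simp add: y0_def)
    then have "0 < y" "0 < G y" using G_pos by simp_all
    then show ?thesis using y1[of y] that by (simp add: y0_def field_simps)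
  qed
  have pow: "2^k * y * G (2^k * y) \<le> sqrt (2^k) * (y * G y)" if y: "y0 \<le> y" for y k
  proof (induction k)
    case (Suc k)
    have y0: "0 < y" "y0 \<le> 2^k * y"
    proof -
      show *: "0 < y" using y by (simp add: y0_def)
      have "1 * y \<le> 2^k * y" using * by (intro mult_right_mono) auto
      then show "y0 \<le> 2^k * y" using y by simp
    qed
    have "2^Suc k * y * G (2^Suc k * y) \<le> sqrt 2 * (2^k * y * G (2^k * y))"
      using dbl[OF y0(2)] by (simp add: mult_ac)
    also have "\<dots> \<le> sqrt 2 * (sqrt (2^k) * (y * G y))" using Suc by (intro mult_left_mono) auto
    finally show ?case by (simp add: real_sqrt_mult mult_ac)
  qed simp
  have dyadic: "H (2^k * y) - H y \<le> 4 * (y * G y) * sqrt (2^k)" if y: "y0 \<le> y" for y k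
  proof (induction k)
    case 0
    have "0 < y" using y by (simp add: y0_def)
    then show ?case using G_pos[of y] by (simp add: less_imp_le)
  next
    case (Suc k)
    have y': "0 < y" using y by (simp add: y0_def)
    then have yG: "0 < y * G y" using G_pos by simp
    have "H (2^Suc k * y) - H (2^k * y) \<le> (2^Suc k * y - 2^k * y) * G (2^k * y)"
      using y' by (intro increment_upper) auto
    also have "\<dots> = 2^k * y * G (2^k * y)" by (simp add: algebra_simps)
    also have "\<dots> \<le> sqrt (2^k) * (y * G y)" by (rule pow[OF y])
    finally have "H (2^Suc k * y) - H y \<le> 5 * (sqrt (2^k) * (y * G y))"
      using Suc by (simp add: algebra_simps)
    also have "\<dots> \<le> (4 * sqrt 2) * (sqrt (2^k) * (y * G y))"
    proof (rule mult_right_mono)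
      \<comment> \<open>The constant 4 survives the induction: the new block adds one more unit, and
        \<open>4 + 1 <= 4 * sqrt 2\<close>.\<close>
      have "5 / 4 \<le> sqrt 2" by (rule real_le_rsqrt) (simp add: power2_eq_square)
      then show "5 \<le> 4 * sqrt 2" by simp
    qed (use yG in auto)
    finally show ?case by (simp add: real_sqrt_mult mult_ac)
  qed
  show ?thesis
  proof (intro exI[of _ y0] conjI allI impI)
    fix y z :: real assume y: "y0 \<le> y" and z: "1 \<le> z"
    have y': "0 < y" using y by (simp add: y0_def)
    then have yG: "0 < y * G y" using G_pos by simp
    define k where "k = nat \<lfloor>log 2 z\<rfloor>"
    have "0 \<le> log 2 z" using z by simp
    then have kk: "real k \<le> log 2 z" "log 2 z < real k + 1" unfolding k_def by linarith+
    have "2 powr real k \<le> z" using kk(1) z by (simp add: le_log_iff)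
    then have k1: "2^k \<le> z" by (simp add: powr_realpow)
    have "z < 2 powr real (Suc k)" using kk(2) z by (simp add: log_less_iff add.commute)
    then have k2: "z < 2^Suc k" by (subst (asm) powr_realpow) auto
    have "H (z * y) \<le> H (2^Suc k * y)" using k2 y' z by (intro H_mono mult_right_mono) auto
    then have "H (z * y) - H y \<le> 4 * (y * G y) * sqrt (2^Suc k)" using dyadic[OF y, of "Suc k"] by linarith
    also have "\<dots> \<le> 4 * (y * G y) * (2 * sqrt z)"
    proof (rule mult_left_mono)
      \<comment> \<open>Rounding \<open>2 * z\<close> up to \<open>4 * z\<close> gives the root
        \<open>2 * sqrt z\<close>, which turns the constant 4 into 8.\<close>
      have "sqrt (2^Suc k) \<le> sqrt (4 * z)"
      proof (rule real_sqrt_le_mono)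
        show "2 ^ Suc k \<le> 4 * z" using k1 z by simp
      qed
      then show "sqrt (2^Suc k) \<le> 2 * sqrt z" by (simp add: real_sqrt_mult)
    qed (use yG in auto)
    finally show "H (z * y) - H y \<le> 8 * (y * G y) * sqrt z" by simp
  qed (simp add: y0_def)
qed

text \<open>By \<open>ratio_at_top\<close>, eventually \<open>8 * (y * G y) <= H y\<close>, so the
  increment is at most \<open>sqrt z * H y\<close>; a second such term covers \<open>H y\<close>
  itself. With \<open>G\<close> eliminated, the bound can compare values of \<open>H\<close> at any
  two large points.\<close>

lemma H_sqrt_bound: "\<exists>y0>0. \<forall>y\<ge>y0. \<forall>z\<ge>1. H (z * y) \<le> 2 * sqrt z * H y"
proof -
  obtain y0 where y0: "0 < y0" "\<And>y z. y0 \<le> y \<Longrightarrow> 1 \<le> z \<Longrightarrow> H (z * y) - H y \<le> 8 * (y * G y) * sqrt z"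
    using increment_sqrt_bound by blast
  have "eventually (\<lambda>x. 8 \<le> H x / (x * G x)) at_top"
    using ratio_at_top by (simp add: filterlim_at_top)
  then obtain y1 where y1: "\<And>y. y1 \<le> y \<Longrightarrow> 8 \<le> H y / (y * G y)"
    unfolding eventually_at_top_linorder by blast
  have "H (z * y) \<le> 2 * sqrt z * H y" if y: "max y0 y1 \<le> y" and z: "1 \<le> z" for y z
  proof -
    have "0 < y" using y y0(1) by simp
    then have pos: "0 < y * G y" "0 < H y" using G_pos H_pos by simp_all
    have "8 * (y * G y) \<le> H y" using y1[of y] y pos by (simp add: field_simps)
    then have "8 * (y * G y) * sqrt z \<le> H y * sqrt z" using z by (intro mult_right_mono) auto
    moreover have "H y \<le> H y * sqrt z" using z pos by simp
    moreover have "H (z * y) - H y \<le> 8 * (y * G y) * sqrt z" using y0(2)[of y z] y z by simp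
    ultimately have "H (z * y) - H y \<le> H y * sqrt z" "H y \<le> H y * sqrt z" by (blast intro: order_trans)+
    then have "H (z * y) - H y + H y \<le> H y * sqrt z + H y * sqrt z" by (rule add_mono)
    then show ?thesis by (simp add: mult_ac)
  qed
  then show ?thesis using y0(1) by (intro exI[of _ "max y0 y1"]) auto
qed

text \<open>Meant for \<open>h = H 1\<close>: the integral in \<open>ell_star\<close> starts at 1
  and so differs from the truncated mean by this constant, which is negligible because
  \<open>H\<close> is unbounded.\<close>

lemma H_shift_equiv: "((\<lambda>y. (H y - h) / H y) \<longlongrightarrow> 1) at_top"
proof -
  have "((\<lambda>y. 1 - h * inverse (H y)) \<longlongrightarrow> 1 - h * 0) at_top"
    by (intro tendsto_intros tendsto_inverse_0_at_top H_at_top)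
  moreover have "eventually (\<lambda>y. 1 - h * inverse (H y) = (H y - h) / H y) at_top"
    using eventually_gt_at_top[of 0]
  proof eventually_elim
    case (elim y)
    then show ?case using H_pos[of y] by (simp add: field_simps)
  qed
  ultimately show ?thesis by (simp add: tendsto_cong)
qed

lemma shifted_ratio_at_top: "filterlim (\<lambda>y. (H y - h) / (y * G y)) at_top at_top"
proof -
  have lim: "filterlim (\<lambda>y. (H y - h) / H y * (H y / (y * G y))) at_top at_top"
    by (rule filterlim_tendsto_pos_mult_at_top[OF H_shift_equiv _ ratio_at_top]) simp
  have eq: "eventually (\<lambda>y. (H y - h) / H y * (H y / (y * G y)) = (H y - h) / (y * G y)) at_top"
    using eventually_gt_at_top[of 0]
  proof eventually_elim
    case (elim y)
    then show ?case using H_pos[of y] by simp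
  qed
  from iffD1[OF filterlim_cong[OF refl refl eq] lim] show ?thesis .
qed

text \<open>The dilation factor tends to infinity, so slow variation of \<open>H\<close> alone does not give this.\<close>

lemma H_normalised_equiv:
  "((\<lambda>y. H ((H y - h) / (y * G y) * y) / H y) \<longlongrightarrow> 1) at_top"
proof -
  define z where "z y = (H y - h) / (y * G y)" for y
  have z: "filterlim z at_top at_top" unfolding z_def by (rule shifted_ratio_at_top)
  obtain y0 where y0: "0 < y0" "\<And>y z. y0 \<le> y \<Longrightarrow> 1 \<le> z \<Longrightarrow> H (z * y) - H y \<le> 8 * (y * G y) * sqrt z"
    using increment_sqrt_bound by blast
  have z1: "eventually (\<lambda>y. 1 \<le> z y) at_top" using z by (simp add: filterlim_at_top)
  have ev: "eventually (\<lambda>y. y0 \<le> y) at_top" by (rule eventually_ge_at_top)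
  have "((\<lambda>y. H (z y * y) / H y) \<longlongrightarrow> 1) at_top"
  proof (rule real_tendsto_sandwich)
    show "((\<lambda>x::real. 1::real) \<longlongrightarrow> 1) at_top" by simp
    have "filterlim (\<lambda>y. sqrt (z y)) at_top at_top"
      by (rule filterlim_compose[OF sqrt_at_top z])
    then have "((\<lambda>y. 1 + 8 * ((H y - h) / H y) * inverse (sqrt (z y))) \<longlongrightarrow> 1 + 8 * 1 * 0) at_top"
      by (intro tendsto_intros tendsto_inverse_0_at_top H_shift_equiv)
    then show "((\<lambda>y. 1 + 8 * ((H y - h) / H y) * inverse (sqrt (z y))) \<longlongrightarrow> 1) at_top" by simp
    show "eventually (\<lambda>y. 1 \<le> H (z y * y) / H y) at_top"
      using z1 ev
    proof eventually_elim
      case (elim y)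
      then have "0 < y" using y0 by simp
      then show ?case using H_mono[of y "z y * y"] H_pos[of y] elim by simp
    qed
    show "eventually (\<lambda>y. H (z y * y) / H y \<le> 1 + 8 * ((H y - h) / H y) * inverse (sqrt (z y))) at_top"
      using z1 ev
    proof eventually_elim
      case (elim y)
      then have y: "0 < y" using y0 by simp
      then have pos: "0 < y * G y" "0 < H y" using G_pos H_pos by simp_all
      \<comment> \<open>This identity makes the bound useful: \<open>H y - h\<close> contains a full
        factor \<open>z y\<close>, so the growth \<open>sqrt (z y)\<close> of the increment becomes
        \<open>1 / sqrt (z y)\<close> relative to \<open>H y\<close>.\<close>
      have zz: "H y - h = z y * (y * G y)" using y G_pos[OF y] by (simp add: z_def)
      have "z y = sqrt (z y) * sqrt (z y)" using elim by simp
      then have "8 * ((H y - h) / H y) * inverse (sqrt (z y)) = 8 * (y * G y) * sqrt (z y) / H y"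
        unfolding zz using elim pos by (simp add: divide_simps)
      moreover have "(H (z y * y) - H y) / H y \<le> 8 * (y * G y) * sqrt (z y) / H y"
        using y0(2)[of y "z y"] elim pos by (intro divide_right_mono) auto
      ultimately show ?case using pos by (simp add: diff_divide_distrib)
    qed
  qed
  then show ?thesis by (simp add: z_def)
qed

end

section \<open>Powers of a Laplace transform\<close>

lemma nn_integral_exp_scale:
  assumes "0 < (c::real)"
  shows "(\<integral>\<^sup>+ x. ennreal (exp (- (x * c))) * indicator {0<..} x \<partial>lborel) = ennreal (1 / c)"
proof -
  have "1 = (\<integral>\<^sup>+ x. ennreal (exp (- x)) * indicator {0..} x \<partial>lborel)"
    using nn_intergal_power_times_exp_Ici[of 0] by simp
  also have "\<dots> = ennreal c * (\<integral>\<^sup>+ x. ennreal (exp (- (c * x))) * indicator {0..} (c * x) \<partial>lborel)"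
    using assms by (subst nn_integral_real_affine[where c=c and t=0]) auto
  also have "(\<integral>\<^sup>+ x. ennreal (exp (- (c * x))) * indicator {0..} (c * x) \<partial>lborel)
           = (\<integral>\<^sup>+ x. ennreal (exp (- (x * c))) * indicator {0<..} x \<partial>lborel)"
  proof (rule nn_integral_cong_AE)
    show "AE x in lborel. ennreal (exp (- (c * x))) * indicator {0..} (c * x)
            = ennreal (exp (- (x * c))) * indicator {0<..} x"
      using AE_lborel_singleton[of 0]
    proof eventually_elim
      case (elim x)
      have "0 \<le> c * x \<longleftrightarrow> 0 < x" using assms elim by (auto simp: zero_le_mult_iff)
      then show ?case by (simp add: indicator_def mult.commute)
    qed
  qed
  finally have *: "ennreal c * (\<integral>\<^sup>+ x. ennreal (exp (- (x * c))) * indicator {0<..} x \<partial>lborel) = 1" ..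
  have "ennreal (1 / c) = ennreal (1 / c) * (ennreal c *
      (\<integral>\<^sup>+ x. ennreal (exp (- (x * c))) * indicator {0<..} x \<partial>lborel))"
    by (simp only: * mult_1_right)
  also have "\<dots> = (\<integral>\<^sup>+ x. ennreal (exp (- (x * c))) * indicator {0<..} x \<partial>lborel)"
    using assms by (simp add: mult.assoc[symmetric] ennreal_mult[symmetric])
  finally show ?thesis ..
qed

text \<open>The purpose is an integrable majorant. As \<open>s^2\<close> is the fourth power of
  \<open>sqrt s\<close>, the exponent is split into four equal parts \<open>sqrt s / 64\<close>,
  whence \<open>64^4\<close>; the factor 2 absorbs the 1 in \<open>1 + s^2\<close>.\<close>

lemma exp_neg_sqrt_bound:
  assumes "1 \<le> (s::real)"
  shows "exp (- (sqrt s / 16)) \<le> 2 * 64^4 / (1 + s\<^sup>2)"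
proof -
  have "(sqrt s / 64)^4 \<le> (1 + sqrt s / 64)^4" using assms by (intro power_mono) auto
  also have "\<dots> \<le> exp (sqrt s / 64)^4" using assms by (intro power_mono exp_ge_add_one_self) auto
  also have "\<dots> = exp (sqrt s / 16)" by (simp flip: exp_of_nat_mult)
  finally have "(sqrt s / 64)^4 \<le> exp (sqrt s / 16)" .
  moreover have "sqrt s ^ 4 = s\<^sup>2"
  proof -
    have "sqrt s ^ 4 = ((sqrt s)\<^sup>2)\<^sup>2" by (simp flip: power_mult)
    then show ?thesis using assms by simp
  qed
  ultimately have "s\<^sup>2 \<le> 64^4 * exp (sqrt s / 16)" by (simp add: power_divide)
  moreover have "1 + s\<^sup>2 \<le> 2 * s\<^sup>2" using assms by (simp add: one_le_power)
  ultimately have "1 + s\<^sup>2 \<le> 2 * 64^4 * exp (sqrt s / 16)" by linarith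
  then show ?thesis by (simp add: exp_minus field_simps add_pos_nonneg)
qed

lemma square_times_power_tendsto_0:
  assumes q: "0 < (q::real)" "q < 1"
  shows "(\<lambda>n. (real n)\<^sup>2 * q^n) \<longlonglongrightarrow> 0"
proof -
  have "(\<lambda>n. real n * sqrt q ^ n) \<longlonglongrightarrow> 0"
    using powser_times_n_limit_0[of "sqrt q"] q by simp
  then have "(\<lambda>n. (real n * sqrt q ^ n)\<^sup>2) \<longlonglongrightarrow> 0\<^sup>2" by (rule tendsto_power)
  moreover have "(real n * sqrt q ^ n)\<^sup>2 = (real n)\<^sup>2 * q^n" for n
  proof -
    have "(sqrt q ^ n)\<^sup>2 = (sqrt q * sqrt q)^n" by (simp only: power2_eq_square power_mult_distrib)
    then show ?thesis using q by (simp add: power_mult_distrib)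
  qed
  ultimately show ?thesis by simp
qed

text \<open>The numerator varies with \<open>n\<close>, so the logarithm is squeezed:
  \<open>1 - 1 / y <= ln y <= y - 1\<close> at \<open>y = 1 - x n / n\<close>, and after
  multiplication by \<open>n\<close> both outer terms tend to \<open>- s\<close>.\<close>

lemma one_minus_div_power_tendsto_exp:
  assumes x: "x \<longlonglongrightarrow> s"
  shows "(\<lambda>n. (1 - x n / real n)^n) \<longlonglongrightarrow> exp (- s)"
proof -
  have x0: "(\<lambda>n. x n / real n) \<longlonglongrightarrow> 0"
    by (rule real_tendsto_divide_at_top[OF x filterlim_real_sequentially])
  have ev: "eventually (\<lambda>n. x n / real n < 1/2) sequentially"
    by (rule order_tendstoD(2)[OF x0]) simp
  have "(\<lambda>n. real n * ln (1 - x n / real n)) \<longlonglongrightarrow> - s"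
  proof (rule real_tendsto_sandwich)
    have "(\<lambda>n. - x n / (1 - x n / real n)) \<longlonglongrightarrow> - s / (1 - 0)"
      by (intro tendsto_intros x x0) simp
    then show "(\<lambda>n. - x n / (1 - x n / real n)) \<longlonglongrightarrow> - s" by simp
    show "(\<lambda>n. - x n) \<longlonglongrightarrow> - s" by (intro tendsto_intros x)
    show "eventually (\<lambda>n. real n * ln (1 - x n / real n) \<le> - x n) sequentially"
      using ev eventually_gt_at_top[of 0]
    proof eventually_elim
      case (elim n)
      then have "ln (1 - x n / real n) \<le> - (x n / real n)"
        using ln_le_minus_one[of "1 - x n / real n"] by simp
      then have "real n * ln (1 - x n / real n) \<le> real n * - (x n / real n)"
        by (rule mult_left_mono) simp
      then show ?case using elim by simp
    qed
    show "eventually (\<lambda>n. - x n / (1 - x n / real n) \<le> real n * ln (1 - x n / real n)) sequentially"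
      using ev eventually_gt_at_top[of 0]
    proof eventually_elim
      case (elim n)
      define y where "y = 1 - x n / real n"
      have y: "0 < y" using elim by (simp add: y_def)
      have "ln (1 / y) \<le> 1 / y - 1" using y by (intro ln_le_minus_one) simp
      then have "1 - 1 / y \<le> ln y" using y by (simp add: ln_div)
      then have "real n * (1 - 1 / y) \<le> real n * ln y" by (rule mult_left_mono) simp
      moreover have "real n * (1 - 1 / y) = - x n / y"
      proof -
        have "1 - 1 / y = (y - 1) / y" using y by (simp add: field_simps)
        moreover have "real n * (y - 1) = - x n" using elim by (simp add: y_def)
        ultimately show ?thesis by (metis times_divide_eq_right)
      qed
      ultimately show ?case by (simp add: y_def)
    qed
  qed
  then have "(\<lambda>n. exp (real n * ln (1 - x n / real n))) \<longlonglongrightarrow> exp (- s)" by (rule tendsto_exp)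
  moreover have "eventually (\<lambda>n. exp (real n * ln (1 - x n / real n)) = (1 - x n / real n)^n) sequentially"
    using ev
  proof eventually_elim
    case (elim n)
    then have "0 < 1 - x n / real n" by linarith
    then show ?case by (simp add: exp_of_nat_mult)
  qed
  ultimately show ?thesis by (rule Lim_transform_eventually)
qed

text \<open>The two bounds on \<open>1 - \<phi>\<close> hold for the Laplace transform \<open>\<phi>\<close> of a law with truncated mean
  \<open>H\<close>; they come from \<open>(1 - d) min x d \<le> 1 - exp (-x) \<le> min x 1\<close>.\<close>

locale laplace_integrated_tail = integrated_tail +
  fixes \<phi> :: "real \<Rightarrow> real"
  assumes phi_lower: "0 < d \<Longrightarrow> d < 1 \<Longrightarrow> 0 < t \<Longrightarrow> (1 - d) * (t * H (d / t)) \<le> 1 - \<phi> t"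
    and phi_upper: "0 < t \<Longrightarrow> 1 - \<phi> t \<le> t * H (1 / t)"
    and phi_nonneg: "0 \<le> \<phi> t"
    and phi_antimono: "0 < s \<Longrightarrow> s \<le> t \<Longrightarrow> \<phi> t \<le> \<phi> s"
    and phi_measurable[measurable]: "\<phi> \<in> borel_measurable borel"
begin

lemma phi_less_1:
  assumes "0 < t" shows "\<phi> t < 1"
proof -
  have "0 < (1 - 1/2) * (t * H (1/2 / t))" using H_pos[of "1/2/t"] assms by simp
  also have "\<dots> \<le> 1 - \<phi> t" using assms by (intro phi_lower) auto
  finally show ?thesis by simp
qed

text \<open>Slow variation makes fixed dilations harmless:
  \<open>n * (s / a n) * H (c * a n)\<close> tends to \<open>s\<close> for every
  \<open>c > 0\<close>. The choices \<open>c = 1 / s\<close> and \<open>c = d / s\<close> are what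
  the upper and lower bounds on \<open>1 - \<phi>\<close> produce.\<close>

lemma phi_power_tendsto:
  fixes a :: "nat \<Rightarrow> real"
  assumes a: "filterlim a at_top sequentially"
    and nH: "(\<lambda>n. real n * H (a n) / a n) \<longlonglongrightarrow> 1"
    and s: "0 < s"
  shows "(\<lambda>n. \<phi> (s / a n) ^ n) \<longlonglongrightarrow> exp (- s)"
proof -
  have apos: "eventually (\<lambda>n. 0 < a n) sequentially" using a by (simp add: filterlim_at_top_dense)
  have lim: "(\<lambda>n. s * (real n * H (a n) / a n) * (H (c * a n) / H (a n))) \<longlonglongrightarrow> s" if "0 < c" for c
    using tendsto_mult[OF tendsto_mult[OF tendsto_const[of s] nH] filterlim_compose[OF H_slow[OF that] a]]
    by simp
  have eq: "eventually (\<lambda>n. s * (real n * H (a n) / a n) * (H (c * a n) / H (a n))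
      = real n * (s / a n * H (c * a n))) sequentially" for c
    using apos
  proof eventually_elim
    case (elim n)
    then show ?case using H_pos[of "a n"] by simp
  qed
  have lim': "(\<lambda>n. real n * (s / a n * H (c * a n))) \<longlonglongrightarrow> s" if "0 < c" for c
    using tendsto_cong[OF eq[of c]] lim[OF that] by simp
  have "(\<lambda>n. real n * (1 - \<phi> (s / a n))) \<longlonglongrightarrow> s"
  proof (rule order_tendstoI)
    fix u assume u: "s < u"
    have "eventually (\<lambda>n. real n * (s / a n * H (1 / s * a n)) < u) sequentially"
      using u s by (intro order_tendstoD(2)[OF lim']) auto
    with apos show "eventually (\<lambda>n. real n * (1 - \<phi> (s / a n)) < u) sequentially"
    proof eventually_elim
      case (elim n)
      then have "1 - \<phi> (s / a n) \<le> s / a n * H (1 / s * a n)"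
        using phi_upper[of "s / a n"] s by simp
      then have "real n * (1 - \<phi> (s / a n)) \<le> real n * (s / a n * H (1 / s * a n))"
        by (rule mult_left_mono) simp
      then show ?case using elim by simp
    qed
  next
    fix l assume l: "l < s"
    \<comment> \<open>Small enough that the loss \<open>1 - d\<close> of the lower bound still
      leaves \<open>(1 - d) * s > l\<close>.\<close>
    define d where "d = min (1/2) ((s - l) / (2 * s))"
    have d: "0 < d" "d < 1" using l s by (auto simp: d_def)
    have "s * d \<le> s * ((s - l) / (2 * s))" using s unfolding d_def by (intro mult_left_mono) auto
    also have "\<dots> = (s - l) / 2" using s by simp
    also have "\<dots> < s - l" using l by simp
    finally have ls: "l < (1 - d) * s" by (simp add: algebra_simps)
    have "(\<lambda>n. (1 - d) * (real n * (s / a n * H (d / s * a n)))) \<longlonglongrightarrow> (1 - d) * s"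
      using d s by (intro tendsto_intros lim') auto
    then have "eventually (\<lambda>n. l < (1 - d) * (real n * (s / a n * H (d / s * a n)))) sequentially"
      using ls by (rule order_tendstoD(1))
    with apos show "eventually (\<lambda>n. l < real n * (1 - \<phi> (s / a n))) sequentially"
    proof eventually_elim
      case (elim n)
      then have "(1 - d) * (s / a n * H (d / s * a n)) \<le> 1 - \<phi> (s / a n)"
        using phi_lower[OF d, of "s / a n"] s by simp
      then have "real n * ((1 - d) * (s / a n * H (d / s * a n))) \<le> real n * (1 - \<phi> (s / a n))"
        by (rule mult_left_mono) simp
      then show ?case using elim(2) by (simp only: mult.left_commute)
    qed
  qed
  from one_minus_div_power_tendsto_exp[OF this]
  show ?thesis
  proof (rule Lim_transform_eventually)
    show "eventually (\<lambda>n. (1 - real n * (1 - \<phi> (s / a n)) / real n) ^ n = \<phi> (s / a n) ^ n) sequentially"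
      using eventually_gt_at_top[of 0] by eventually_elim simp
  qed
qed

text \<open>The lower bound with \<open>d = 1/2\<close> involves \<open>H (a n / (2 * s))\<close>.
  Passing to \<open>H (a n)\<close> is a dilation by \<open>2 * s\<close> and costs only a multiple
  of \<open>sqrt s\<close>, so of the factor \<open>s\<close> in front a multiple of
  \<open>sqrt s\<close> remains in the exponent.\<close>

lemma phi_power_dominated:
  fixes a :: "nat \<Rightarrow> real"
  assumes a: "filterlim a at_top sequentially"
    and nH: "(\<lambda>n. real n * H (a n) / a n) \<longlonglongrightarrow> 1"
  shows "\<exists>r>0. eventually (\<lambda>n. \<forall>s. 0 < s \<longrightarrow> s \<le> r * a n \<longrightarrow>
           \<phi> (s / a n) ^ n \<le> 2 * 64^4 / (1 + s\<^sup>2)) sequentially"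
proof -
  obtain y0 where y0: "0 < y0" "\<And>y z. y0 \<le> y \<Longrightarrow> 1 \<le> z \<Longrightarrow> H (z * y) \<le> 2 * sqrt z * H y"
    using H_sqrt_bound by blast
  have apos: "eventually (\<lambda>n. 0 < a n) sequentially" using a by (simp add: filterlim_at_top_dense)
  have half: "eventually (\<lambda>n. 1/2 < real n * H (a n) / a n) sequentially"
    by (rule order_tendstoD(1)[OF nH]) simp
  show ?thesis
  \<comment> \<open>Exactly the range in which \<open>a n / (2 * s)\<close> stays above the
    threshold \<open>y0\<close> of \<open>H_sqrt_bound\<close>.\<close>
  proof (intro exI[of _ "1 / (2 * y0)"] conjI)
    show "eventually (\<lambda>n. \<forall>s. 0 < s \<longrightarrow> s \<le> 1 / (2 * y0) * a n \<longrightarrow>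
           \<phi> (s / a n) ^ n \<le> 2 * 64^4 / (1 + s\<^sup>2)) sequentially"
      using apos half
    proof eventually_elim
      case (elim n)
      show ?case
      proof (intro allI impI)
        fix s assume s: "0 < s" "s \<le> 1 / (2 * y0) * a n"
        have t: "0 < s / a n" using s elim by simp
        show "\<phi> (s / a n) ^ n \<le> 2 * 64^4 / (1 + s\<^sup>2)"
        proof (cases "1 \<le> s")
          case True
          define p where "p = 1 - \<phi> (s / a n)"
          have y: "y0 \<le> a n / (2 * s)" using s y0(1) by (simp add: field_simps)
          have "H (a n) \<le> 2 * sqrt (2 * s) * H (a n / (2 * s))"
            using y0(2)[OF y, of "2 * s"] True by simp
          also have "\<dots> \<le> 4 * sqrt s * H (a n / (2 * s))"
          proof (rule mult_right_mono)
            have "sqrt (2 * s) \<le> sqrt (4 * s)" using s by (intro real_sqrt_le_mono) simp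
            moreover have "sqrt (4 * s) = 2 * sqrt s" by (simp add: real_sqrt_mult)
            ultimately show "2 * sqrt (2 * s) \<le> 4 * sqrt s" by linarith
            have "0 < a n / (2 * s)" using s elim by simp
            then show "0 \<le> H (a n / (2 * s))" using H_pos by (simp add: less_imp_le)
          qed
          finally have h: "H (a n) \<le> 4 * sqrt s * H (a n / (2 * s))" .
          have "sqrt s / 16 = (1/2) * (sqrt s / 8)" by simp
          also have "\<dots> \<le> (real n * H (a n) / a n) * (sqrt s / 8)"
            using elim s by (intro mult_right_mono) auto
          also have "\<dots> = real n / a n * (sqrt s / 8) * H (a n)" by simp
          also have "\<dots> \<le> real n / a n * (sqrt s / 8) * (4 * sqrt s * H (a n / (2 * s)))"
            using elim s by (intro mult_left_mono[OF h]) auto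
          also have "\<dots> = real n * ((1/2) * ((sqrt s * sqrt s) / a n * H (a n / (2 * s))))"
            by (simp add: field_simps del: real_sqrt_mult_self)
          also have "\<dots> = real n * ((1/2) * (s / a n * H (a n / (2 * s))))" using s by simp
          also have "\<dots> \<le> real n * p"
            using phi_lower[of "1/2", OF _ _ t] unfolding p_def by (intro mult_left_mono) auto
          finally have np: "sqrt s / 16 \<le> real n * p" .
          have "\<phi> (s / a n) \<le> exp (- p)" using exp_ge_add_one_self[of "- p"] by (simp add: p_def)
          then have "\<phi> (s / a n) ^ n \<le> exp (- p) ^ n" by (intro power_mono phi_nonneg)
          also have "\<dots> = exp (- (real n * p))" by (simp flip: exp_of_nat_mult)
          also have "\<dots> \<le> exp (- (sqrt s / 16))" using np by simp
          also have "\<dots> \<le> 2 * 64^4 / (1 + s\<^sup>2)" by (rule exp_neg_sqrt_bound[OF True])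
          finally show ?thesis .
        next
          case False
          \<comment> \<open>For \<open>s < 1\<close> the trivial bound 1 suffices, since the
            majorant is then above 1.\<close>
          have "\<phi> (s / a n) ^ n \<le> 1"
            using phi_less_1[OF t] phi_nonneg by (intro power_le_one) auto
          also have "1 \<le> 2 * 64^4 / (1 + s\<^sup>2)"
          proof -
            have "s\<^sup>2 \<le> 1" using False s by (intro power_le_one) auto
            then show ?thesis by (simp add: le_divide_eq add_pos_nonneg)
          qed
          finally show ?thesis .
        qed
      qed
    qed
  qed (use y0 in auto)
qed

text \<open>\<open>H_sqrt_bound\<close> at the fixed base point \<open>y0\<close> gives
  \<open>H (a n) = O(sqrt (a n))\<close>. Inserted into \<open>a n <= 2 * n * H (a n)\<close> and
  divided by \<open>sqrt (a n)\<close>, this bounds \<open>sqrt (a n)\<close> linearly in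
  \<open>n\<close>.\<close>

lemma scale_quadratic_bound:
  fixes a :: "nat \<Rightarrow> real"
  assumes a: "filterlim a at_top sequentially"
    and nH: "(\<lambda>n. real n * H (a n) / a n) \<longlonglongrightarrow> 1"
  shows "\<exists>C. eventually (\<lambda>n. a n \<le> C * (real n)\<^sup>2) sequentially"
proof -
  obtain y0 where y0: "0 < y0" "\<And>y z. y0 \<le> y \<Longrightarrow> 1 \<le> z \<Longrightarrow> H (z * y) \<le> 2 * sqrt z * H y"
    using H_sqrt_bound by blast
  define C where "C = 4 * H y0 / sqrt y0"
  have half: "eventually (\<lambda>n. 1/2 < real n * H (a n) / a n) sequentially"
    by (rule order_tendstoD(1)[OF nH]) simp
  have "eventually (\<lambda>n. y0 \<le> a n) sequentially" using a by (simp add: filterlim_at_top)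
  with half have "eventually (\<lambda>n. a n \<le> C\<^sup>2 * (real n)\<^sup>2) sequentially"
  proof eventually_elim
    case (elim n)
    have apos: "0 < a n" using elim y0 by simp
    have "H (a n) \<le> 2 * sqrt (a n / y0) * H y0"
      using y0(2)[of y0 "a n / y0"] elim y0(1) by simp
    then have "2 * H (a n) \<le> 2 * (2 * sqrt (a n / y0) * H y0)" by (rule mult_left_mono) simp
    also have "\<dots> = C * sqrt (a n)" by (simp add: C_def real_sqrt_divide)
    finally have h: "2 * H (a n) \<le> C * sqrt (a n)" .
    have "sqrt (a n) * sqrt (a n) = a n" using apos by simp
    also have "\<dots> \<le> real n * (2 * H (a n))" using elim apos by (simp add: field_simps)
    also have "\<dots> \<le> real n * (C * sqrt (a n))" by (intro mult_left_mono[OF h]) simp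
    finally have "sqrt (a n) * sqrt (a n) \<le> (real n * C) * sqrt (a n)" by (simp add: mult_ac)
    then have "sqrt (a n) \<le> real n * C" by (rule mult_right_le_imp_le) (simp add: apos)
    then have "(sqrt (a n))\<^sup>2 \<le> (real n * C)\<^sup>2" using apos by (intro power_mono) auto
    then show ?case using apos by (simp add: power_mult_distrib mult.commute)
  qed
  then show ?thesis by blast
qed

lemma tail_integral_tendsto_0:
  fixes a :: "nat \<Rightarrow> real"
  assumes a: "filterlim a at_top sequentially"
    and nH: "(\<lambda>n. real n * H (a n) / a n) \<longlonglongrightarrow> 1"
    and fin: "(\<integral>\<^sup>+ t. ennreal (\<phi> t ^ m) * indicator {0<..} t \<partial>lborel) < \<infinity>"
    and r: "0 < r"
  shows "(\<lambda>n. ennreal (a n) * (\<integral>\<^sup>+ t. ennreal (\<phi> t ^ n) * indicator {r<..} t \<partial>lborel)) \<longlonglongrightarrow> 0"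
proof -
  obtain j where j: "0 \<le> j" "(\<integral>\<^sup>+ t. ennreal (\<phi> t ^ m) * indicator {0<..} t \<partial>lborel) = ennreal j"
    using fin by (cases "\<integral>\<^sup>+ t. ennreal (\<phi> t ^ m) * indicator {0<..} t \<partial>lborel") auto
  obtain C where C: "eventually (\<lambda>n. a n \<le> C * (real n)\<^sup>2) sequentially"
    using scale_quadratic_bound[OF a nH] by blast
  \<comment> \<open>The lower bound 1/2 keeps \<open>q\<close> positive whatever the value of
    \<open>\<phi> r\<close>, so that \<open>q^(n - m)\<close> can be written as
    \<open>q^n / q^m\<close>.\<close>
  define q where "q = max (\<phi> r) (1/2)"
  have q: "0 < q" "q < 1" "\<phi> r \<le> q" using phi_less_1[OF r] by (auto simp: q_def)
  have "(\<lambda>n. ennreal (C / q^m * ((real n)\<^sup>2 * q^n) * j)) \<longlonglongrightarrow> ennreal (C / q^m * 0 * j)"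
    by (intro tendsto_ennrealI tendsto_intros square_times_power_tendsto_0 q)
  then have lim: "(\<lambda>n. ennreal (C / q^m * ((real n)\<^sup>2 * q^n) * j)) \<longlonglongrightarrow> 0" by simp
  have apos: "eventually (\<lambda>n. 0 < a n) sequentially" using a by (simp add: filterlim_at_top_dense)
  show ?thesis
  proof (rule tendsto_sandwich[OF _ _ tendsto_const lim])
    show "eventually (\<lambda>n. ennreal (a n) * (\<integral>\<^sup>+ t. ennreal (\<phi> t ^ n) * indicator {r<..} t \<partial>lborel)
        \<le> ennreal (C / q^m * ((real n)\<^sup>2 * q^n) * j)) sequentially"
      using C eventually_ge_at_top[of m] apos
    proof eventually_elim
      case (elim n)
      have "(\<integral>\<^sup>+ t. ennreal (\<phi> t ^ n) * indicator {r<..} t \<partial>lborel)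
          \<le> (\<integral>\<^sup>+ t. ennreal (q^(n - m)) * (ennreal (\<phi> t ^ m) * indicator {0<..} t) \<partial>lborel)"
      proof (rule nn_integral_mono)
        fix t :: real
        show "ennreal (\<phi> t ^ n) * indicator {r<..} t
            \<le> ennreal (q^(n - m)) * (ennreal (\<phi> t ^ m) * indicator {0<..} t)"
        proof (cases "r < t")
          case True
          have "\<phi> t \<le> q" using phi_antimono[of r t] True r q by simp
          then have "\<phi> t ^ (n - m) \<le> q ^ (n - m)" by (intro power_mono phi_nonneg)
          then have "\<phi> t ^ (n - m) * \<phi> t ^ m \<le> q ^ (n - m) * \<phi> t ^ m"
            by (rule mult_right_mono) (simp add: phi_nonneg)
          then have "\<phi> t ^ n \<le> q ^ (n - m) * \<phi> t ^ m"
            using elim by (simp flip: power_add)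
          then show ?thesis using True r q by (simp add: ennreal_mult'[symmetric] ennreal_leI)
        qed simp
      qed
      also have "\<dots> = ennreal (q^(n - m)) * ennreal j"
        by (subst nn_integral_cmult) (simp_all add: j(2))
      also have "\<dots> = ennreal (q^(n - m) * j)" using q by (intro ennreal_mult'[symmetric]) simp
      finally have "ennreal (a n) * (\<integral>\<^sup>+ t. ennreal (\<phi> t ^ n) * indicator {r<..} t \<partial>lborel)
          \<le> ennreal (a n) * ennreal (q^(n - m) * j)" by (rule mult_left_mono) simp
      also have "\<dots> = ennreal (a n * (q^(n - m) * j))" using elim by (intro ennreal_mult'[symmetric]) simp
      also have "\<dots> \<le> ennreal (C / q^m * ((real n)\<^sup>2 * q^n) * j)"
      proof (rule ennreal_leI)
        have "a n * (q^(n - m) * j) \<le> C * (real n)\<^sup>2 * (q^(n - m) * j)"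
          using elim q j by (intro mult_right_mono) auto
        also have "q^(n - m) = q^n / q^m" using elim q by (simp add: power_diff)
        finally show "a n * (q^(n - m) * j) \<le> C / q^m * ((real n)\<^sup>2 * q^n) * j"
          using elim q by (simp add: power_diff)
      qed
      finally show ?case .
    qed
  qed simp
qed

lemma main_integral_tendsto_1:
  fixes a :: "nat \<Rightarrow> real"
  assumes a: "filterlim a at_top sequentially"
    and nH: "(\<lambda>n. real n * H (a n) / a n) \<longlonglongrightarrow> 1"
    and r: "0 < r"
    and dom: "eventually (\<lambda>n. \<forall>s. 0 < s \<longrightarrow> s \<le> r * a n \<longrightarrow>
           \<phi> (s / a n) ^ n \<le> 2 * 64^4 / (1 + s\<^sup>2)) sequentially"
  shows "(\<lambda>n. \<integral>\<^sup>+ s. ennreal (\<phi> (s / a n) ^ n) * indicator {0<..r * a n} s \<partial>lborel) \<longlonglongrightarrow> 1"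
proof -
  define u where "u n s = ennreal (\<phi> (s / a n) ^ n) * indicator {0<..r * a n} s" for n and s :: real
  have u_meas: "u n \<in> borel_measurable lborel" for n unfolding u_def by measurable
  obtain n0 where n0: "\<And>n s. n0 \<le> n \<Longrightarrow> 0 < s \<Longrightarrow> s \<le> r * a n \<Longrightarrow> \<phi> (s / a n) ^ n \<le> 2 * 64^4 / (1 + s\<^sup>2)"
    using dom unfolding eventually_sequentially by blast
  have "(\<lambda>n. \<integral>\<^sup>+ s. u (n + n0) s \<partial>lborel)
      \<longlonglongrightarrow> (\<integral>\<^sup>+ s. ennreal (exp (- (s * 1))) * indicator {0<..} s \<partial>lborel)"
  \<comment> \<open>The majorant is valid only from \<open>n0\<close> on, whereas dominated
    convergence asks for it at every index; hence the shift by \<open>n0\<close>.\<close>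
  proof (rule nn_integral_dominated_convergence)
    show "AE s in lborel. u (n + n0) s \<le> ennreal (2 * 64^4 * inverse (1 + s\<^sup>2))" for n
    proof (intro AE_I2)
      fix s :: real
      show "u (n + n0) s \<le> ennreal (2 * 64^4 * inverse (1 + s\<^sup>2))"
      proof (cases "0 < s \<and> s \<le> r * a (n + n0)")
        case True
        then show ?thesis using n0[of "n + n0" s] by (simp add: u_def ennreal_leI divide_inverse)
      qed (auto simp: u_def indicator_def)
    qed
    have "integrable lborel (\<lambda>s::real. 2 * 64^4 * inverse (1 + s\<^sup>2))"
      using integrable_inverse_1_plus_square by (simp add: set_integrable_def)
    then show "(\<integral>\<^sup>+ s. ennreal (2 * 64^4 * inverse (1 + s\<^sup>2)) \<partial>lborel) < \<infinity>"
      by (subst nn_integral_eq_integral) (auto simp: add_nonneg_nonneg)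
    show "AE s in lborel. (\<lambda>n. u (n + n0) s) \<longlonglongrightarrow> ennreal (exp (- (s * 1))) * indicator {0<..} s"
    proof (intro AE_I2)
      fix s :: real
      have "(\<lambda>n. u n s) \<longlonglongrightarrow> ennreal (exp (- (s * 1))) * indicator {0<..} s"
      proof (cases "0 < s")
        case True
        have "(\<lambda>n. ennreal (\<phi> (s / a n) ^ n)) \<longlonglongrightarrow> ennreal (exp (- s))"
          by (intro tendsto_ennrealI phi_power_tendsto a nH True)
        moreover have "eventually (\<lambda>n. ennreal (\<phi> (s / a n) ^ n) = u n s) sequentially"
        proof -
          \<comment> \<open>For fixed \<open>s\<close> the cutoff \<open>r * a n\<close> eventually
            passes \<open>s\<close>, so the indicator disappears in the limit.\<close>
          have "eventually (\<lambda>n. s / r \<le> a n) sequentially" using a by (simp add: filterlim_at_top)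
          then show ?thesis
          proof eventually_elim
            case (elim n)
            then have "s \<le> r * a n" using r by (simp add: field_simps)
            then show ?case using True by (simp add: u_def)
          qed
        qed
        ultimately have "(\<lambda>n. u n s) \<longlonglongrightarrow> ennreal (exp (- s))" by (rule Lim_transform_eventually)
        then show ?thesis using True by simp
      qed (simp add: u_def)
      then show "(\<lambda>n. u (n + n0) s) \<longlonglongrightarrow> ennreal (exp (- (s * 1))) * indicator {0<..} s"
        by (rule LIMSEQ_ignore_initial_segment)
    qed
  qed (use u_meas in auto)
  then have "(\<lambda>n. \<integral>\<^sup>+ s. u (n + n0) s \<partial>lborel) \<longlonglongrightarrow> 1"
    using nn_integral_exp_scale[of 1] by simp
  then show ?thesis unfolding u_def[symmetric] by (rule LIMSEQ_offset)
qed

theorem laplace_power_integral_tendsto: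
  fixes a :: "nat \<Rightarrow> real"
  assumes a: "filterlim a at_top sequentially"
    and nH: "(\<lambda>n. real n * H (a n) / a n) \<longlonglongrightarrow> 1"
    and fin: "(\<integral>\<^sup>+ t. ennreal (\<phi> t ^ m) * indicator {0<..} t \<partial>lborel) < \<infinity>"
  shows "(\<lambda>n. ennreal (a n) * (\<integral>\<^sup>+ t. ennreal (\<phi> t ^ n) * indicator {0<..} t \<partial>lborel)) \<longlonglongrightarrow> 1"
proof -
  obtain r where r: "0 < r" and dom: "eventually (\<lambda>n. \<forall>s. 0 < s \<longrightarrow> s \<le> r * a n \<longrightarrow>
           \<phi> (s / a n) ^ n \<le> 2 * 64^4 / (1 + s\<^sup>2)) sequentially"
    using phi_power_dominated[OF a nH] by blast
  have "(\<lambda>n. (\<integral>\<^sup>+ s. ennreal (\<phi> (s / a n) ^ n) * indicator {0<..r * a n} s \<partial>lborel)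
      + ennreal (a n) * (\<integral>\<^sup>+ t. ennreal (\<phi> t ^ n) * indicator {r<..} t \<partial>lborel)) \<longlonglongrightarrow> 1 + 0"
    by (intro tendsto_add main_integral_tendsto_1[OF a nH r dom] tail_integral_tendsto_0[OF a nH fin r])
  moreover have "eventually (\<lambda>n. (\<integral>\<^sup>+ s. ennreal (\<phi> (s / a n) ^ n) * indicator {0<..r * a n} s \<partial>lborel)
      + ennreal (a n) * (\<integral>\<^sup>+ t. ennreal (\<phi> t ^ n) * indicator {r<..} t \<partial>lborel)
      = ennreal (a n) * (\<integral>\<^sup>+ t. ennreal (\<phi> t ^ n) * indicator {0<..} t \<partial>lborel)) sequentially"
  proof -
    have apos: "eventually (\<lambda>n. 0 < a n) sequentially" using a by (simp add: filterlim_at_top_dense)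
    then show ?thesis
    proof eventually_elim
      case (elim n)
      have "(\<integral>\<^sup>+ t. ennreal (\<phi> t ^ n) * indicator {0<..} t \<partial>lborel)
          = (\<integral>\<^sup>+ t. ennreal (\<phi> t ^ n) * indicator {0<..r} t + ennreal (\<phi> t ^ n) * indicator {r<..} t \<partial>lborel)"
        using r by (intro nn_integral_cong) (auto simp: indicator_def)
      also have "\<dots> = (\<integral>\<^sup>+ t. ennreal (\<phi> t ^ n) * indicator {0<..r} t \<partial>lborel)
          + (\<integral>\<^sup>+ t. ennreal (\<phi> t ^ n) * indicator {r<..} t \<partial>lborel)"
        by (rule nn_integral_add) measurable
      finally have split: "(\<integral>\<^sup>+ t. ennreal (\<phi> t ^ n) * indicator {0<..} t \<partial>lborel)
        = (\<integral>\<^sup>+ t. ennreal (\<phi> t ^ n) * indicator {0<..r} t \<partial>lborel)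
          + (\<integral>\<^sup>+ t. ennreal (\<phi> t ^ n) * indicator {r<..} t \<partial>lborel)" .
      have "(\<integral>\<^sup>+ s. ennreal (\<phi> (s / a n) ^ n) * indicator {0<..r * a n} s \<partial>lborel)
          = ennreal \<bar>a n\<bar> * (\<integral>\<^sup>+ t. ennreal (\<phi> ((0 + a n * t) / a n) ^ n) * indicator {0<..r * a n} (0 + a n * t) \<partial>lborel)"
        \<comment> \<open>The substitution \<open>s = a n * t\<close> supplies the prefactor
          \<open>a n\<close> and moves the cutoff to \<open>r\<close>.\<close>
        using elim by (intro nn_integral_real_affine) auto
      also have "(\<integral>\<^sup>+ t. ennreal (\<phi> ((0 + a n * t) / a n) ^ n) * indicator {0<..r * a n} (0 + a n * t) \<partial>lborel)
         = (\<integral>\<^sup>+ t. ennreal (\<phi> t ^ n) * indicator {0<..r} t \<partial>lborel)"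
      proof (rule nn_integral_cong)
        fix t :: real
        have "0 < a n * t \<and> a n * t \<le> r * a n \<longleftrightarrow> 0 < t \<and> t \<le> r"
          using elim by (simp add: zero_less_mult_iff mult.commute[of r])
        then show "ennreal (\<phi> ((0 + a n * t) / a n) ^ n) * indicator {0<..r * a n} (0 + a n * t)
            = ennreal (\<phi> t ^ n) * indicator {0<..r} t"
          using elim by (simp add: indicator_def)
      qed
      finally show ?case using elim by (simp add: split distrib_left)
    qed
  qed
  ultimately show ?thesis by (simp add: Lim_transform_eventually)
qed

end

section \<open>Truncated means and Laplace transforms of positive random variables\<close>

context integrated_tail
begin

text \<open>Writing \<open>a n = z n * b n\<close>, both factors tend to infinity, and
  \<open>n * H (a n) / a n\<close> splits into \<open>n * G (b n)\<close>,
  \<open>H (z n * b n) / H (b n)\<close> and \<open>H (b n) / (H (b n) - h)\<close>, each with limit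
  1.\<close>

lemma normalising_sequence:
  fixes b :: "nat \<Rightarrow> real"
  assumes b: "filterlim b at_top sequentially"
    and nG: "(\<lambda>n. real n * G (b n)) \<longlonglongrightarrow> 1"
    and a_def: "\<And>n. a n = (H (b n) - h) / G (b n)"
  shows "filterlim a at_top sequentially"
    and "(\<lambda>n. real n * H (a n) / a n) \<longlonglongrightarrow> 1"
proof -
  define z where "z n = (H (b n) - h) / (b n * G (b n))" for n
  have z: "filterlim z at_top sequentially"
    unfolding z_def by (rule filterlim_compose[OF shifted_ratio_at_top b])
  have bpos: "eventually (\<lambda>n. 0 < b n) sequentially" using b by (simp add: filterlim_at_top_dense)
  have az: "eventually (\<lambda>n. z n * b n = a n) sequentially"
    using bpos
  proof eventually_elim
    case (elim n)
    then show ?case by (simp add: z_def a_def)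
  qed
  have "filterlim (\<lambda>n. z n * b n) at_top sequentially"
    by (rule filterlim_at_top_mult_at_top[OF z b])
  from iffD1[OF filterlim_cong[OF refl refl az] this] show "filterlim a at_top sequentially" .
  have "(\<lambda>n. real n * G (b n) * (H (z n * b n) / H (b n)) * inverse ((H (b n) - h) / H (b n)))
      \<longlonglongrightarrow> 1 * 1 * inverse 1"
    unfolding z_def
    by (intro tendsto_intros nG filterlim_compose[OF H_normalised_equiv b]
        filterlim_compose[OF H_shift_equiv b]) simp
  then have "(\<lambda>n. real n * G (b n) * (H (z n * b n) / H (b n)) * inverse ((H (b n) - h) / H (b n)))
      \<longlonglongrightarrow> 1" by simp
  moreover have "eventually (\<lambda>n. real n * G (b n) * (H (z n * b n) / H (b n)) * inverse ((H (b n) - h) / H (b n))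
      = real n * H (a n) / a n) sequentially"
    using bpos az
  proof eventually_elim
    case (elim n)
    then show ?case using H_pos[of "b n"] G_pos[of "b n"] by (simp add: a_def divide_inverse mult_ac)
  qed
  ultimately show "(\<lambda>n. real n * H (a n) / a n) \<longlonglongrightarrow> 1" by (rule Lim_transform_eventually)
qed

end

section \<open>Tail, truncated mean and Laplace transform of one positive variable\<close>

context prob_space
begin

text \<open>The tail is closed, to match the assumption on \<open>L\<close>; at an atom it differs
  from one minus the distribution function.\<close>

definition survival :: "('a \<Rightarrow> real) \<Rightarrow> real \<Rightarrow> real" where
  "survival X x = prob {\<omega> \<in> space M. x \<le> X \<omega>}"

text \<open>For positive \<open>X\<close> and \<open>y > 0\<close> this is the integral of the tail
  over (0, \<open>y\<close>). The expectation form also covers the part below 1, about which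
  \<open>L\<close> says nothing.\<close>

definition truncated_mean :: "('a \<Rightarrow> real) \<Rightarrow> real \<Rightarrow> real" where
  "truncated_mean X y = expectation (\<lambda>\<omega>. min (X \<omega>) y)"

definition laplace :: "('a \<Rightarrow> real) \<Rightarrow> real \<Rightarrow> real" where
  "laplace X t = expectation (\<lambda>\<omega>. exp (- (t * X \<omega>)))"

context
  fixes X :: "'a \<Rightarrow> real"
  assumes X[measurable]: "X \<in> borel_measurable M" and Xpos: "AE \<omega> in M. 0 < X \<omega>"
begin

lemma survival_antimono: "x \<le> y \<Longrightarrow> survival X y \<le> survival X x"
  unfolding survival_def by (rule finite_measure_mono) auto

lemma survival_measurable[measurable]: "survival X \<in> borel_measurable borel"
proof -
  have "(\<lambda>x. - survival X x) \<in> borel_measurable borel"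
    by (rule borel_measurable_mono) (auto simp: mono_def survival_antimono)
  then have "(\<lambda>x. - (- survival X x)) \<in> borel_measurable borel" by measurable
  then show ?thesis by simp
qed

lemma survival_eq_expectation: "survival X x = expectation (\<lambda>\<omega>. indicator {x..} (X \<omega>))"
proof -
  have "expectation (\<lambda>\<omega>. indicator {x..} (X \<omega>)) = expectation (indicator {\<omega> \<in> space M. x \<le> X \<omega>})"
    by (intro Bochner_Integration.integral_cong) (auto simp: indicator_def)
  also have "\<dots> = survival X x" by (simp add: survival_def Collect_conj_eq Int_absorb1 Int_commute)
  finally show ?thesis ..
qed

lemma integrable_min: "0 < y \<Longrightarrow> integrable M (\<lambda>\<omega>. min (X \<omega>) y)"
  by (rule integrable_const_bound[where B=y]) (use Xpos in \<open>auto elim: eventually_mono\<close>)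

lemma integrable_survival: "integrable M (\<lambda>\<omega>. indicator {x..} (X \<omega>) :: real)"
  by (rule integrable_const_bound[where B=1]) (auto simp: indicator_def)

lemma integrable_laplace: "0 < t \<Longrightarrow> integrable M (\<lambda>\<omega>. exp (- (t * X \<omega>)))"
  by (rule integrable_const_bound[where B=1]) (use Xpos in \<open>auto elim!: eventually_mono\<close>)

lemma truncated_mean_increment_lower:
  assumes "0 < x" "x \<le> y"
  shows "(y - x) * survival X y \<le> truncated_mean X y - truncated_mean X x"
proof -
  have "(y - x) * survival X y = expectation (\<lambda>\<omega>. (y - x) * indicator {y..} (X \<omega>))"
    by (simp add: survival_eq_expectation)
  also have "\<dots> \<le> expectation (\<lambda>\<omega>. min (X \<omega>) y - min (X \<omega>) x)"
    using assms by (intro integral_mono Bochner_Integration.integrable_diff integrable_min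
        integrable_mult_right integrable_survival) (auto simp: indicator_def)
  also have "\<dots> = truncated_mean X y - truncated_mean X x"
    using assms by (simp add: truncated_mean_def integrable_min)
  finally show ?thesis .
qed

lemma truncated_mean_increment_upper:
  assumes "0 < x" "x \<le> y"
  shows "truncated_mean X y - truncated_mean X x \<le> (y - x) * survival X x"
proof -
  have "truncated_mean X y - truncated_mean X x = expectation (\<lambda>\<omega>. min (X \<omega>) y - min (X \<omega>) x)"
    using assms by (simp add: truncated_mean_def integrable_min)
  also have "\<dots> \<le> expectation (\<lambda>\<omega>. (y - x) * indicator {x..} (X \<omega>))"
    using assms by (intro integral_mono Bochner_Integration.integrable_diff integrable_min
        integrable_mult_right integrable_survival) (auto simp: indicator_def)
  also have "\<dots> = (y - x) * survival X x"
    by (simp add: survival_eq_expectation)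
  finally show ?thesis .
qed

lemma truncated_mean_ge:
  assumes "0 < y" shows "y * survival X y \<le> truncated_mean X y"
proof -
  have "y * survival X y = expectation (\<lambda>\<omega>. y * indicator {y..} (X \<omega>))"
    by (simp add: survival_eq_expectation)
  also have "\<dots> \<le> truncated_mean X y"
    unfolding truncated_mean_def
    using assms Xpos by (intro integral_mono_AE integrable_min integrable_mult_right integrable_survival)
      (auto simp: indicator_def elim: eventually_mono)
  finally show ?thesis .
qed

lemma truncated_mean_at_top:
  assumes inf: "(\<integral>\<^sup>+ \<omega>. ennreal (X \<omega>) \<partial>M) = \<infinity>"
  shows "filterlim (truncated_mean X) at_top at_top"
  unfolding filterlim_at_top
proof
  fix Z :: real
  have "(\<lambda>k. \<integral>\<^sup>+ \<omega>. ennreal (min (X \<omega>) (real k)) \<partial>M) \<longlonglongrightarrow> (\<integral>\<^sup>+ \<omega>. ennreal (X \<omega>) \<partial>M)"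
  proof (rule nn_integral_LIMSEQ)
    show "incseq (\<lambda>k \<omega>. ennreal (min (X \<omega>) (real k)))"
      by (auto simp: incseq_def le_fun_def intro!: ennreal_leI)
    show "(\<lambda>k. ennreal (min (X \<omega>) (real k))) \<longlonglongrightarrow> ennreal (X \<omega>)" for \<omega>
    proof (rule tendsto_eventually)
      obtain k0 where "X \<omega> \<le> real k0" using real_arch_simple by blast
      then show "eventually (\<lambda>k. ennreal (min (X \<omega>) (real k)) = ennreal (X \<omega>)) sequentially"
        by (auto intro!: eventually_sequentiallyI[of k0] simp: min_def)
    qed
  qed measurable
  then have "eventually (\<lambda>k. ennreal Z < (\<integral>\<^sup>+ \<omega>. ennreal (min (X \<omega>) (real k)) \<partial>M)) sequentially"
    by (rule order_tendstoD(1)) (simp add: inf)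
  then have "eventually (\<lambda>k. 0 < k \<and> ennreal Z < (\<integral>\<^sup>+ \<omega>. ennreal (min (X \<omega>) (real k)) \<partial>M)) sequentially"
    using eventually_gt_at_top[of 0] by (rule eventually_elim2) simp
  then obtain k where k: "0 < k" "ennreal Z < (\<integral>\<^sup>+ \<omega>. ennreal (min (X \<omega>) (real k)) \<partial>M)"
    unfolding eventually_sequentially by blast
  have "(\<integral>\<^sup>+ \<omega>. ennreal (min (X \<omega>) (real k)) \<partial>M) = ennreal (truncated_mean X (real k))"
    unfolding truncated_mean_def using k Xpos
    by (intro nn_integral_eq_integral integrable_min) (auto elim: eventually_mono)
  with k(2) have "Z < truncated_mean X (real k)"
    by (metis ennreal_leI not_less)
  \<comment> \<open>Monotone convergence ran over integer levels; monotonicity extends the bound to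
    all real \<open>y\<close> beyond \<open>k\<close>.\<close>
  moreover have "truncated_mean X (real k) \<le> truncated_mean X y" if "real k \<le> y" for y
  proof -
    have "0 \<le> (y - real k) * survival X y" using that by (simp add: survival_def)
    also have "\<dots> \<le> truncated_mean X y - truncated_mean X (real k)"
      using that k(1) by (intro truncated_mean_increment_lower) auto
    finally show ?thesis by simp
  qed
  ultimately show "eventually (\<lambda>y. Z \<le> truncated_mean X y) at_top"
    by (intro eventually_at_top_linorderI[of "real k"]) (meson less_imp_le order_trans)
qed

text \<open>Layer-cake formula: \<open>min (X \<omega>) y - min (X \<omega>) 1\<close> is the length
  of the set of \<open>u\<close> in (1, \<open>y\<close>) with \<open>u <= X \<omega>\<close>, and
  Tonelli exchanges length and probability.\<close>

lemma ell_star_eq_truncated_mean: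
  assumes L: "\<And>u. 1 \<le> u \<Longrightarrow> survival X u = inverse u * L u" and y: "1 \<le> y"
  shows "ell_star L y = truncated_mean X y - truncated_mean X 1"
proof -
  interpret lborel: pair_sigma_finite lborel M
    by unfold_locales
  have "ell_star L y = (LINT u|lborel. indicator {1<..<y} u * (L u / u))"
    using y by (simp add: ell_star_def interval_lebesgue_integral_def einterval_eq set_lebesgue_integral_def)
  \<comment> \<open>Replacing \<open>L u / u\<close> by the monotone tail makes the integrand
    visibly measurable.\<close>
  also have "\<dots> = (LINT u|lborel. indicator {1<..<y} u * survival X u)"
    by (intro Bochner_Integration.integral_cong) (auto simp: indicator_def L divide_inverse mult.commute)
  also have "\<dots> = enn2real (\<integral>\<^sup>+ u. ennreal (indicator {1<..<y} u * survival X u) \<partial>lborel)"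
    by (rule integral_eq_nn_integral) (auto simp: survival_def)
  also have "(\<integral>\<^sup>+ u. ennreal (indicator {1<..<y} u * survival X u) \<partial>lborel)
     = (\<integral>\<^sup>+ u. (\<integral>\<^sup>+ \<omega>. indicator {1<..<y} u * indicator {\<omega> \<in> space M. u \<le> X \<omega>} \<omega> \<partial>M) \<partial>lborel)"
  proof (rule nn_integral_cong)
    fix u :: real
    have "(\<integral>\<^sup>+ \<omega>. indicator {1<..<y} u * indicator {\<omega> \<in> space M. u \<le> X \<omega>} \<omega> \<partial>M)
        = indicator {1<..<y} u * emeasure M {\<omega> \<in> space M. u \<le> X \<omega>}"
      by (subst nn_integral_cmult) auto
    then show "ennreal (indicator {1<..<y} u * survival X u)
        = (\<integral>\<^sup>+ \<omega>. indicator {1<..<y} u * indicator {\<omega> \<in> space M. u \<le> X \<omega>} \<omega> \<partial>M)"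
      by (simp add: survival_def emeasure_eq_measure indicator_def)
  qed
  also have "\<dots> = (\<integral>\<^sup>+ u. (\<integral>\<^sup>+ \<omega>. (if 1 < u \<and> u < y \<and> u \<le> X \<omega> then 1 else 0) \<partial>M) \<partial>lborel)"
    by (intro nn_integral_cong) (auto simp: indicator_def)
  also have "\<dots> = (\<integral>\<^sup>+ \<omega>. (\<integral>\<^sup>+ u. (if 1 < u \<and> u < y \<and> u \<le> X \<omega> then 1 else 0) \<partial>lborel) \<partial>M)"
    by (rule lborel.Fubini'[symmetric]) measurable
  also have "\<dots> = (\<integral>\<^sup>+ \<omega>. ennreal (min (X \<omega>) y - min (X \<omega>) 1) \<partial>M)"
  proof (rule nn_integral_cong)
    fix \<omega>
    have "(\<integral>\<^sup>+ u. (if 1 < u \<and> u < y \<and> u \<le> X \<omega> then 1 else 0) \<partial>lborel)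
        = (\<integral>\<^sup>+ u. indicator (if y \<le> X \<omega> then {1<..<y} else {1<..X \<omega>}) u \<partial>lborel)"
      by (intro nn_integral_cong) (auto simp: indicator_def)
    also have "\<dots> = ennreal (min (X \<omega>) y - min (X \<omega>) 1)"
      \<comment> \<open>If \<open>X \<omega> <= 1\<close>, the interval is empty and the two minima
        coincide.\<close>
      using y by (cases "1 \<le> X \<omega>") (auto simp: min_def not_le)
    finally show "(\<integral>\<^sup>+ u. (if 1 < u \<and> u < y \<and> u \<le> X \<omega> then 1 else 0) \<partial>lborel)
        = ennreal (min (X \<omega>) y - min (X \<omega>) 1)" .
  qed
  also have "enn2real \<dots> = expectation (\<lambda>\<omega>. min (X \<omega>) y - min (X \<omega>) 1)"
    using y by (intro integral_eq_nn_integral[symmetric]) auto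
  also have "\<dots> = truncated_mean X y - truncated_mean X 1"
    using y by (simp add: truncated_mean_def integrable_min)
  finally show ?thesis .
qed

lemma laplace_lower:
  assumes d: "0 < d" "d < 1" and t: "0 < t"
  shows "(1 - d) * (t * truncated_mean X (d / t)) \<le> 1 - laplace X t"
proof -
  \<comment> \<open>With \<open>m = min x d\<close>, \<open>m <= d\<close> gives
    \<open>(1 - d) * (1 + m) <= 1\<close>, so \<open>(1 - d) * m <= 1 - 1 / (1 + m)\<close>, and
    \<open>1 + m <= exp m\<close> finishes.\<close>
  have key: "(1 - d) * min x d \<le> 1 - exp (- x)" if x: "0 < x" for x :: real
  proof -
    define m where "m = min x d"
    have m: "0 < m" "m \<le> d" "m \<le> x" using x d by (auto simp: m_def)
    have "0 \<le> d * m" using m d by simp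
    moreover have "(1 - d) * (1 + m) = 1 + m - d - d * m" by (simp add: algebra_simps)
    ultimately have "(1 - d) * (1 + m) \<le> 1" using m(2) by linarith
    then have "m * ((1 - d) * (1 + m)) \<le> m" using m by (simp add: mult_left_le)
    then have "(1 - d) * m \<le> m / (1 + m)" using m by (simp add: field_simps)
    also have "\<dots> = 1 - inverse (1 + m)" using m by (simp add: field_simps)
    also have "\<dots> \<le> 1 - inverse (exp m)"
      using m exp_ge_add_one_self[of m] by (simp add: le_imp_inverse_le)
    also have "\<dots> \<le> 1 - exp (- x)" using m by (simp add: exp_minus le_imp_inverse_le)
    finally show ?thesis by (simp add: m_def)
  qed
  have "(1 - d) * (t * truncated_mean X (d / t))
      = expectation (\<lambda>\<omega>. (1 - d) * (t * min (X \<omega>) (d / t)))"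
    by (simp add: truncated_mean_def)
  also have "\<dots> \<le> expectation (\<lambda>\<omega>. 1 - exp (- (t * X \<omega>)))"
  proof (rule integral_mono_AE)
    show "integrable M (\<lambda>\<omega>. (1 - d) * (t * min (X \<omega>) (d / t)))"
      using d t by (intro integrable_mult_right integrable_min) auto
    show "integrable M (\<lambda>\<omega>. 1 - exp (- (t * X \<omega>)))"
      using t by (intro Bochner_Integration.integrable_diff integrable_laplace) auto
    show "AE \<omega> in M. (1 - d) * (t * min (X \<omega>) (d / t)) \<le> 1 - exp (- (t * X \<omega>))"
      using Xpos
    proof eventually_elim
      case (elim \<omega>)
      have "t * min (X \<omega>) (d / t) = min (t * X \<omega>) d" using t by (simp add: min_mult_distrib_left)
      then show ?case using key[of "t * X \<omega>"] t elim by simp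
    qed
  qed
  also have "\<dots> = 1 - laplace X t" using t by (simp add: laplace_def integrable_laplace prob_space)
  finally show ?thesis .
qed

lemma laplace_upper:
  assumes t: "0 < t"
  shows "1 - laplace X t \<le> t * truncated_mean X (1 / t)"
proof -
  have "1 - laplace X t = expectation (\<lambda>\<omega>. 1 - exp (- (t * X \<omega>)))"
    using t by (simp add: laplace_def integrable_laplace prob_space)
  also have "\<dots> \<le> expectation (\<lambda>\<omega>. t * min (X \<omega>) (1 / t))"
  proof (rule integral_mono)
    show "integrable M (\<lambda>\<omega>. t * min (X \<omega>) (1 / t))"
      using t by (intro integrable_mult_right integrable_min) auto
    show "integrable M (\<lambda>\<omega>. 1 - exp (- (t * X \<omega>)))"
      using t by (intro Bochner_Integration.integrable_diff integrable_laplace) auto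
    show "1 - exp (- (t * X \<omega>)) \<le> t * min (X \<omega>) (1 / t)" for \<omega>
    proof -
      have "t * min (X \<omega>) (1 / t) = min (t * X \<omega>) 1" using t by (simp add: min_mult_distrib_left)
      then show ?thesis using exp_ge_add_one_self[of "- (t * X \<omega>)"] by (simp add: min_def)
    qed
  qed
  also have "\<dots> = t * truncated_mean X (1 / t)" by (simp add: truncated_mean_def)
  finally show ?thesis .
qed

lemma laplace_nonneg: "0 \<le> laplace X t"
  unfolding laplace_def by (rule Bochner_Integration.integral_nonneg) simp

lemma laplace_antimono:
  assumes "0 < s" "s \<le> t" shows "laplace X t \<le> laplace X s"
  unfolding laplace_def
  using assms Xpos by (intro integral_mono_AE integrable_laplace) (auto elim!: eventually_mono)

lemma laplace_measurable: "laplace X \<in> borel_measurable borel"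
  unfolding laplace_def[abs_def] by measurable

lemma laplace_integrated_tail_truncated_mean:
  assumes inf: "(\<integral>\<^sup>+ \<omega>. ennreal (X \<omega>) \<partial>M) = \<infinity>"
    and L: "\<And>u. 1 \<le> u \<Longrightarrow> survival X u = inverse u * L u"
    and sv: "slowly_varying L"
  shows "laplace_integrated_tail (truncated_mean X) (survival X) (laplace X)"
proof
  obtain x0 where x0: "\<And>x. x0 \<le> x \<Longrightarrow> 0 < L x" using sv by (auto simp: slowly_varying_def)
  show Gpos: "0 < survival X x" if "0 < x" for x
  proof -
    \<comment> \<open>Positivity of \<open>L\<close> is known only near infinity; monotonicity of
      the tail carries it down to \<open>x\<close>.\<close>
    define y where "y = max (max x x0) 1"
    have "0 < survival X y" using L[of y] x0[of y] by (simp add: y_def)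
    also have "\<dots> \<le> survival X x" by (rule survival_antimono) (simp add: y_def)
    finally show ?thesis .
  qed
  show "0 < truncated_mean X x" if "0 < x" for x
    using truncated_mean_ge[OF that] mult_pos_pos[OF that Gpos[OF that]] by linarith
  show "((\<lambda>x. (c * x * survival X (c * x)) / (x * survival X x)) \<longlongrightarrow> 1) at_top" if c: "0 < c" for c
  proof -
    have "((\<lambda>x. L (c * x) / L x) \<longlongrightarrow> 1) at_top" using sv c by (simp add: slowly_varying_def)
    \<comment> \<open>Both \<open>x\<close> and \<open>c * x\<close> must be at least 1 for the tail
      to be expressed through \<open>L\<close>.\<close>
    moreover have "eventually (\<lambda>x. L (c * x) / L x = (c * x * survival X (c * x)) / (x * survival X x)) at_top"
      using eventually_ge_at_top[of 1] eventually_ge_at_top[of "1 / c"]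
    proof eventually_elim
      case (elim x)
      then have "1 \<le> c * x" using c by (simp add: field_simps)
      then show ?case using elim c by (simp add: L)
    qed
    ultimately show ?thesis by (rule Lim_transform_eventually)
  qed
qed (fact truncated_mean_increment_lower truncated_mean_increment_upper truncated_mean_at_top[OF inf]
  laplace_lower laplace_upper laplace_nonneg laplace_antimono laplace_measurable)+

end

text \<open>The lower half of the quantile condition bounds the closed tail at \<open>b n\<close>
  from below. The upper half controls it only strictly beyond \<open>b n\<close>, as there may be an
  atom there. Slow variation closes the gap: \<open>survival X (b n) / survival X (c * b n)\<close>
  tends to \<open>c\<close>, for \<open>c > 1\<close> arbitrarily near 1.\<close>

lemma survival_quantile_tendsto:
  assumes X[measurable]: "X \<in> borel_measurable M"
    and G_pos: "\<And>x. 0 < x \<Longrightarrow> 0 < survival X x"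
    and slow: "\<And>c. 0 < c \<Longrightarrow> ((\<lambda>x. (c * x * survival X (c * x)) / (x * survival X x)) \<longlongrightarrow> 1) at_top"
    and q: "\<And>n. 1 \<le> n \<Longrightarrow> is_quantile (distr M borel X) (1 - 1 / real n) (b n)"
  shows "filterlim b at_top sequentially"
    and "(\<lambda>n. real n * survival X (b n)) \<longlonglongrightarrow> 1"
proof -
  have low: "1 \<le> real n * survival X (b n)" if n: "1 \<le> n" for n
  proof -
    have "measure (distr M borel X) {..<b n} = prob {\<omega> \<in> space M. X \<omega> < b n}"
      by (subst measure_distr) (auto intro!: arg_cong[where f=prob])
    also have "\<dots> = 1 - survival X (b n)"
      unfolding survival_def by (subst prob_compl[symmetric]) (auto intro!: arg_cong[where f=prob])
    finally have "1 / real n \<le> survival X (b n)"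
      using q[OF n] by (simp add: is_quantile_def)
    then show ?thesis using n by (simp add: field_simps)
  qed
  have up: "real n * survival X y \<le> 1" if n: "1 \<le> n" and y: "b n < y" for n y
  proof -
    have "cdf (distr M borel X) (b n) = prob {\<omega> \<in> space M. X \<omega> \<le> b n}"
      unfolding cdf_def by (subst measure_distr) (auto intro!: arg_cong[where f=prob])
    also have "\<dots> \<le> prob (space M - {\<omega> \<in> space M. y \<le> X \<omega>})"
      using y by (intro finite_measure_mono) auto
    also have "\<dots> = 1 - survival X y" unfolding survival_def by (subst prob_compl) auto
    finally have "survival X y \<le> 1 / real n" using q[OF n] by (simp add: is_quantile_def)
    then show ?thesis using n by (simp add: field_simps)
  qed
  show b: "filterlim b at_top sequentially"
    unfolding filterlim_at_top
  proof
    fix Z :: real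
    define y where "y = max Z 0 + 1"
    have "0 < survival X y" by (rule G_pos) (simp add: y_def)
    moreover obtain n0 :: nat where n0: "1 / survival X y < real n0" using reals_Archimedean2 by blast
    ultimately have "1 < real n * survival X y" if "n0 \<le> n" for n
    proof -
      have "1 / survival X y < real n" using n0 that by (meson less_le_trans of_nat_le_iff)
      then show ?thesis using \<open>0 < survival X y\<close> by (simp add: field_simps)
    qed
    then have "y \<le> b n" if "max 1 n0 \<le> n" for n using up[of n y] that by force
    then show "eventually (\<lambda>n. Z \<le> b n) sequentially"
      unfolding eventually_sequentially y_def by (intro exI[of _ "max 1 n0"]) fastforce
  qed
  have bpos: "eventually (\<lambda>n. 0 < b n) sequentially" using b by (simp add: filterlim_at_top_dense)
  show "(\<lambda>n. real n * survival X (b n)) \<longlonglongrightarrow> 1"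
  proof (rule order_tendstoI)
    fix l :: real assume "l < 1"
    then show "eventually (\<lambda>n. l < real n * survival X (b n)) sequentially"
      using low by (auto intro!: eventually_sequentiallyI[of 1] intro: less_le_trans)
  next
    fix u :: real assume u: "1 < u"
    \<comment> \<open>Any \<open>c\<close> strictly between 1 and \<open>u\<close> serves: strictly
      above 1 to step past the atom, below \<open>u\<close> for the limit.\<close>
    define c where "c = (1 + u) / 2"
    have c: "1 < c" "c < u" using u by (auto simp: c_def)
    have "(\<lambda>n. c * inverse ((c * b n * survival X (c * b n)) / (b n * survival X (b n)))) \<longlonglongrightarrow> c * inverse 1"
      using c by (intro tendsto_intros filterlim_compose[OF slow b]) auto
    then have "eventually (\<lambda>n. c * inverse ((c * b n * survival X (c * b n)) / (b n * survival X (b n))) < u) sequentially"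
      using c by (intro order_tendstoD(2)) auto
    with bpos eventually_ge_at_top[of 1]
    show "eventually (\<lambda>n. real n * survival X (b n) < u) sequentially"
    proof eventually_elim
      case (elim n)
      have pos: "0 < survival X (c * b n)" "0 < survival X (b n)" using elim c by (auto intro!: G_pos)
      have "real n * survival X (c * b n) \<le> 1" using up[of n "c * b n"] elim c by simp
      then have "(real n * survival X (c * b n)) * (survival X (b n) / survival X (c * b n))
          \<le> 1 * (survival X (b n) / survival X (c * b n))"
        using pos by (intro mult_right_mono) auto
      then have "real n * survival X (b n) \<le> survival X (b n) / survival X (c * b n)" using pos by simp
      also have "\<dots> = c * inverse ((c * b n * survival X (c * b n)) / (b n * survival X (b n)))"
        using elim c pos by (simp add: field_simps)
      finally show ?case using elim by linarith
    qed
  qed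
qed

end

section \<open>Partial sums of independent identically distributed variables\<close>

lemma iid_seq_measurable:
  assumes "prob_space M" "iid_seq M X" "1 \<le> i"
  shows "X i \<in> borel_measurable M"
proof -
  interpret prob_space M by fact
  show ?thesis using assms unfolding iid_seq_def indep_vars_def by auto
qed

lemma iid_seq_distr: "iid_seq M X \<Longrightarrow> 1 \<le> i \<Longrightarrow> distr M borel (X i) = distr M borel (X 1)"
  unfolding iid_seq_def by blast

lemma iid_seq_indep: "iid_seq M X \<Longrightarrow> prob_space.indep_vars M (\<lambda>_. borel) X {1..}"
  unfolding iid_seq_def by (rule conjunct1)

lemma partial_sum_measurable:
  assumes "prob_space M" "iid_seq M X"
  shows "partial_sum X n \<in> borel_measurable M"
  unfolding partial_sum_def[abs_def]
  by (intro borel_measurable_sum iid_seq_measurable[OF assms]) auto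

lemma iid_seq_AE:
  assumes "prob_space M" "iid_seq M X" "1 \<le> i"
    and P[measurable]: "Measurable.pred borel P" and AE1: "AE \<omega> in M. P (X 1 \<omega>)"
  shows "AE \<omega> in M. P (X i \<omega>)"
proof -
  have X: "X i \<in> borel_measurable M" "X 1 \<in> borel_measurable M"
    using iid_seq_measurable[OF assms(1,2)] assms(3) by auto
  have "AE x in distr M borel (X 1). P x" using AE1 by (subst AE_distr_iff[OF X(2)]) auto
  then have "AE x in distr M borel (X i). P x" by (simp only: iid_seq_distr[OF assms(2,3)])
  then show ?thesis by (subst (asm) AE_distr_iff[OF X(1)]) auto
qed

lemma iid_seq_compose:
  assumes "prob_space M" "iid_seq M X" and f[measurable]: "f \<in> borel_measurable borel"
  shows "iid_seq M (\<lambda>i \<omega>. f (X i \<omega>))"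
proof -
  interpret prob_space M by fact
  have "distr M borel (\<lambda>\<omega>. f (X i \<omega>)) = distr M borel (\<lambda>\<omega>. f (X 1 \<omega>))" if "1 \<le> i" for i
  proof -
    have D: "distr M borel (\<lambda>\<omega>. f (X j \<omega>)) = distr (distr M borel (X j)) borel f" if "1 \<le> j" for j
      using iid_seq_measurable[OF assms(1,2) that] by (simp add: distr_distr comp_def)
    show ?thesis by (simp only: D[OF that] D[OF order_refl] iid_seq_distr[OF assms(2) that])
  qed
  moreover have "indep_vars (\<lambda>_. borel) (\<lambda>i \<omega>. f (X i \<omega>)) {1..}"
    by (rule indep_vars_compose2[OF iid_seq_indep[OF assms(2)]]) (rule f)
  ultimately show ?thesis unfolding iid_seq_def by blast
qed

text \<open>Exhibits the law of the sum as a function of the common law and \<open>n\<close> alone,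
  so that sequences on different probability spaces can be compared.\<close>

lemma iid_seq_distr_PiM:
  assumes "prob_space M" "iid_seq M X" "1 \<le> n"
  shows "distr M borel (partial_sum X n)
    = distr (PiM {1..n} (\<lambda>_. distr M borel (X 1))) borel (\<lambda>x. \<Sum>i=1..n. x i)"
proof -
  interpret prob_space M by fact
  have [measurable]: "X i \<in> borel_measurable M" if "i \<in> {1..n}" for i
    using iid_seq_measurable[OF assms(1,2)] that by auto
  have "indep_vars (\<lambda>_. borel) X {1..n}"
    by (rule indep_vars_subset[OF iid_seq_indep[OF assms(2)]]) auto
  moreover have "{1..n} \<noteq> {}" using assms(3) by simp
  ultimately have "distr M (PiM {1..n} (\<lambda>_. borel)) (\<lambda>\<omega>. \<lambda>i\<in>{1..n}. X i \<omega>)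
      = PiM {1..n} (\<lambda>i. distr M borel (X i))"
    by (subst (asm) indep_vars_iff_distr_eq_PiM') auto
  also have "\<dots> = PiM {1..n} (\<lambda>_. distr M borel (X 1))"
    by (intro PiM_cong refl iid_seq_distr[OF assms(2)]) simp
  finally have eq: "PiM {1..n} (\<lambda>_. distr M borel (X 1))
      = distr M (PiM {1..n} (\<lambda>_. borel)) (\<lambda>\<omega>. \<lambda>i\<in>{1..n}. X i \<omega>)" ..
  show ?thesis
    unfolding eq
    by (subst distr_distr) (auto intro!: distr_cong simp: partial_sum_def)
qed

lemma iid_seq_partial_sum_distr_eq:
  assumes "prob_space M" "iid_seq M X" "prob_space N" "iid_seq N Y"
    and "distr M borel (X 1) = distr N borel (Y 1)"
  shows "distr M borel (partial_sum X n) = distr N borel (partial_sum Y n)"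
proof (cases "1 \<le> n")
  case True
  show ?thesis
    by (simp only: iid_seq_distr_PiM[OF assms(1,2) True] iid_seq_distr_PiM[OF assms(3,4) True] assms(5))
next
  case False
  \<comment> \<open>The empty sums are constant, and both laws are the point mass at 0.\<close>
  then have "partial_sum X n = (\<lambda>_. 0)" "partial_sum Y n = (\<lambda>_. 0)"
    by (auto simp: partial_sum_def)
  then show ?thesis using prob_space.distr_const[of M "0::real" borel]
    prob_space.distr_const[of N "0::real" borel] assms(1,3) by simp
qed

lemma (in prob_space) laplace_partial_sum:
  assumes iid: "iid_seq M X" and pos: "\<And>i. 1 \<le> i \<Longrightarrow> AE \<omega> in M. 0 < X i \<omega>"
    and t: "0 < t"
  shows "(\<integral>\<^sup>+ \<omega>. ennreal (exp (- (t * partial_sum X n \<omega>))) \<partial>M) = ennreal (laplace (X 1) t ^ n)"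
proof -
  have [measurable]: "X i \<in> borel_measurable M" if "1 \<le> i" for i
    using iid_seq_measurable[OF prob_space_axioms iid that] .
  have lap: "expectation (\<lambda>\<omega>. exp (- (t * X i \<omega>))) = laplace (X 1) t" if i: "1 \<le> i" for i
  proof -
    have D: "expectation (\<lambda>\<omega>. exp (- (t * X j \<omega>))) = (LINT x|distr M borel (X j). exp (- (t * x)))"
      if "1 \<le> j" for j
      using that by (subst integral_distr) auto
    show ?thesis by (simp only: D[OF i] D[OF order_refl] iid_seq_distr[OF iid i] laplace_def)
  qed
  have "indep_vars (\<lambda>_. borel) X {1..n}"
    by (rule indep_vars_subset[OF iid_seq_indep[OF iid]]) auto
  then have indep: "indep_vars (\<lambda>_. borel) (\<lambda>i \<omega>. exp (- (t * X i \<omega>))) {1..n}"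
    by (rule indep_vars_compose2[where Y="\<lambda>_ x. exp (- (t * x))"]) auto
  have int: "integrable M (\<lambda>\<omega>. exp (- (t * X i \<omega>)))" if "i \<in> {1..n}" for i
    using that t pos by (intro integrable_laplace) auto
  have exp_eq: "(\<Prod>i\<in>{1..n}. exp (- (t * X i \<omega>))) = exp (- (t * partial_sum X n \<omega>))" for \<omega>
    by (simp add: partial_sum_def exp_sum sum_distrib_left flip: sum_negf)
  have "integrable M (\<lambda>\<omega>. exp (- (t * partial_sum X n \<omega>)))"
    using indep_vars_integrable[OF finite_atLeastAtMost indep int] by (simp only: exp_eq)
  then have "(\<integral>\<^sup>+ \<omega>. ennreal (exp (- (t * partial_sum X n \<omega>))) \<partial>M)
      = ennreal (expectation (\<lambda>\<omega>. exp (- (t * partial_sum X n \<omega>))))"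
    by (intro nn_integral_eq_integral) auto
  also have "expectation (\<lambda>\<omega>. exp (- (t * partial_sum X n \<omega>))) = laplace (X 1) t ^ n"
    using indep_vars_lebesgue_integral[OF finite_atLeastAtMost indep int]
    by (simp only: exp_eq) (simp add: lap)
  finally show ?thesis .
qed

text \<open>Stated with nonnegative integrals because both sides may be infinite for small
  \<open>n\<close>. At \<open>n = 0\<close> it fails: \<open>inverse 0 = 0\<close>, while the right
  side is the length of a half-line.\<close>

lemma (in prob_space) nn_integral_inverse_partial_sum:
  assumes iid: "iid_seq M X" and pos: "\<And>i. 1 \<le> i \<Longrightarrow> AE \<omega> in M. 0 < X i \<omega>"
    and n: "1 \<le> n"
  shows "(\<integral>\<^sup>+ \<omega>. ennreal (inverse (partial_sum X n \<omega>)) \<partial>M)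
    = (\<integral>\<^sup>+ t. ennreal (laplace (X 1) t ^ n) * indicator {0<..} t \<partial>lborel)"
proof -
  interpret L: pair_sigma_finite lborel M by unfold_locales
  have S[measurable]: "partial_sum X n \<in> borel_measurable M"
    by (rule partial_sum_measurable[OF prob_space_axioms iid])
  have "AE \<omega> in M. \<forall>i\<in>{1..n}. 0 < X i \<omega>"
    using pos by (intro AE_finite_allI) auto
  then have "AE \<omega> in M. 0 < partial_sum X n \<omega>"
  proof eventually_elim
    case (elim \<omega>)
    then show ?case using n by (auto simp: partial_sum_def intro!: sum_pos)
  qed
  then have "AE \<omega> in M. ennreal (inverse (partial_sum X n \<omega>))
      = (\<integral>\<^sup>+ t. ennreal (exp (- (t * partial_sum X n \<omega>))) * indicator {0<..} t \<partial>lborel)"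
    by eventually_elim (simp add: nn_integral_exp_scale inverse_eq_divide)
  then have "(\<integral>\<^sup>+ \<omega>. ennreal (inverse (partial_sum X n \<omega>)) \<partial>M)
      = (\<integral>\<^sup>+ \<omega>. (\<integral>\<^sup>+ t. ennreal (exp (- (t * partial_sum X n \<omega>))) * indicator {0<..} t \<partial>lborel) \<partial>M)"
    by (rule nn_integral_cong_AE)
  also have "\<dots> = (\<integral>\<^sup>+ t. (\<integral>\<^sup>+ \<omega>. ennreal (exp (- (t * partial_sum X n \<omega>))) * indicator {0<..} t \<partial>M) \<partial>lborel)"
    by (rule L.Fubini') measurable
  also have "\<dots> = (\<integral>\<^sup>+ t. ennreal (laplace (X 1) t ^ n) * indicator {0<..} t \<partial>lborel)"
  proof (rule nn_integral_cong)
    fix t :: real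
    show "(\<integral>\<^sup>+ \<omega>. ennreal (exp (- (t * partial_sum X n \<omega>))) * indicator {0<..} t \<partial>M)
        = ennreal (laplace (X 1) t ^ n) * indicator {0<..} t"
      using laplace_partial_sum[OF iid pos, of t n] by (cases "0 < t") auto
  qed
  finally show ?thesis .
qed

theorem (in prob_space) inverse_moment_partial_sum_tendsto:
  assumes iid: "iid_seq M X" and pos: "\<And>i. 1 \<le> i \<Longrightarrow> AE \<omega> in M. 0 < X i \<omega>"
    and L: "\<And>x. 1 \<le> x \<Longrightarrow> survival (X 1) x = inverse x * L x"
    and sv: "slowly_varying L"
    and inf: "(\<integral>\<^sup>+ \<omega>. ennreal (X 1 \<omega>) \<partial>M) = \<infinity>"
    and fim: "finite_inverse_moment M X"
    and q: "\<And>n. 1 \<le> n \<Longrightarrow> is_quantile (distr M borel (X 1)) (1 - 1 / real n) (b n)"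
  shows "(\<lambda>n. \<integral>\<omega>. inverse (partial_sum X n \<omega> / b n * (L (b n) / ell_star L (b n))) \<partial>M) \<longlonglongrightarrow> 1"
proof -
  have X1: "X 1 \<in> borel_measurable M"
    by (rule iid_seq_measurable[OF prob_space_axioms iid]) simp
  have pos1: "AE \<omega> in M. 0 < X 1 \<omega>" using pos by simp
  interpret T: laplace_integrated_tail "truncated_mean (X 1)" "survival (X 1)" "laplace (X 1)"
    by (rule laplace_integrated_tail_truncated_mean[OF X1 pos1 inf L sv])
  note b = survival_quantile_tendsto[OF X1 T.G_pos T.slow q]
  define h where "h = truncated_mean (X 1) 1"
  define a where "a n = (truncated_mean (X 1) (b n) - h) / survival (X 1) (b n)" for n
  note a = T.normalising_sequence[OF b a_def]
  define J where "J n = (\<integral>\<^sup>+ \<omega>. ennreal (inverse (partial_sum X n \<omega>)) \<partial>M)" for n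
  have J: "J n = (\<integral>\<^sup>+ t. ennreal (laplace (X 1) t ^ n) * indicator {0<..} t \<partial>lborel)" if "1 \<le> n" for n
    unfolding J_def by (rule nn_integral_inverse_partial_sum[OF iid pos that])
  obtain m where m: "1 \<le> m" "integrable M (\<lambda>\<omega>. inverse (partial_sum X m \<omega>))"
    using fim by (auto simp: finite_inverse_moment_def)
  have "J m \<le> (\<integral>\<^sup>+ \<omega>. ennreal (norm (inverse (partial_sum X m \<omega>))) \<partial>M)"
    unfolding J_def real_norm_def by (intro nn_integral_mono ennreal_leI abs_ge_self)
  also have "\<dots> < \<infinity>" using m(2) unfolding integrable_iff_bounded by blast
  finally have fin: "(\<integral>\<^sup>+ t. ennreal (laplace (X 1) t ^ m) * indicator {0<..} t \<partial>lborel) < \<infinity>"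
    by (simp only: J[OF m(1)])
  have "(\<lambda>n. ennreal (a n) * J n) \<longlonglongrightarrow> 1"
    using T.laplace_power_integral_tendsto[OF a fin]
  proof (rule Lim_transform_eventually)
    show "eventually (\<lambda>n. ennreal (a n) * (\<integral>\<^sup>+ t. ennreal (laplace (X 1) t ^ n) * indicator {0<..} t \<partial>lborel)
        = ennreal (a n) * J n) sequentially"
      using eventually_ge_at_top[of 1] by eventually_elim (simp add: J)
  qed
  \<comment> \<open>Where \<open>J n\<close> is infinite, \<open>enn2real\<close> and the Bochner
    integral both default to 0, so the identification below needs no finiteness of
    \<open>J n\<close>.\<close>
  then have "(\<lambda>n. enn2real (ennreal (a n) * J n)) \<longlonglongrightarrow> 1"
    by (intro tendsto_enn2real) simp_all
  moreover have "eventually (\<lambda>n. 0 < a n) sequentially" using a(1) by (simp add: filterlim_at_top_dense)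
  moreover have "eventually (\<lambda>n. 1 \<le> b n) sequentially" using b(1) by (simp add: filterlim_at_top)
  then have "eventually (\<lambda>n. enn2real (ennreal (a n) * J n)
      = (\<integral>\<omega>. inverse (partial_sum X n \<omega> / b n * (L (b n) / ell_star L (b n))) \<partial>M)) sequentially"
    using eventually_ge_at_top[of 1] \<open>eventually (\<lambda>n. 0 < a n) sequentially\<close>
  proof eventually_elim
    case (elim n)
    have S[measurable]: "partial_sum X n \<in> borel_measurable M"
      by (rule partial_sum_measurable[OF prob_space_axioms iid])
    have "AE \<omega> in M. \<forall>i\<in>{1..n}. 0 < X i \<omega>"
      using pos by (intro AE_finite_allI) auto
    then have nonneg: "AE \<omega> in M. 0 \<le> inverse (partial_sum X n \<omega>)"
      by eventually_elim (auto simp: partial_sum_def intro!: sum_nonneg intro: less_imp_le)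
    \<comment> \<open>Since \<open>b n >= 1\<close>, \<open>L (b n)\<close> is \<open>b n\<close>
      times the tail and \<open>ell_star L (b n)\<close> is \<open>H (b n) - H 1\<close>; this is
      why \<open>h\<close> was chosen as the truncated mean at 1.\<close>
    have "a n = (b n * ell_star L (b n)) / L (b n)"
      using ell_star_eq_truncated_mean[OF X1 pos1 L elim(1)] L[OF elim(1)] elim
      by (simp add: a_def h_def divide_inverse mult_ac)
    then have "inverse (partial_sum X n \<omega> / b n * (L (b n) / ell_star L (b n)))
        = a n * inverse (partial_sum X n \<omega>)" for \<omega>
      by (simp add: divide_inverse mult_ac)
    then have "(\<integral>\<omega>. inverse (partial_sum X n \<omega> / b n * (L (b n) / ell_star L (b n))) \<partial>M)
        = a n * (\<integral>\<omega>. inverse (partial_sum X n \<omega>) \<partial>M)" by simp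
    also have "(\<integral>\<omega>. inverse (partial_sum X n \<omega>) \<partial>M) = enn2real (J n)"
      unfolding J_def by (rule integral_eq_nn_integral[OF _ nonneg]) measurable
    finally show ?case using elim by (simp add: enn2real_mult)
  qed
  ultimately show ?thesis by (blast intro: Lim_transform_eventually)
qed

section \<open>The Pareto law and reciprocals of uniform variables\<close>

lemma ell_star_one:
  assumes "1 \<le> y" shows "ell_star (\<lambda>_. 1) y = ln y"
proof -
  have "(LBINT u=ereal 1..ereal y. 1 / u) = ln y - ln 1"
  proof (rule interval_integral_FTC_finite)
    show "continuous_on {min 1 y..max 1 y} (\<lambda>u. 1 / u)"
      using assms by (intro continuous_intros) auto
    show "(ln has_vector_derivative 1 / x) (at x within {min 1 y..max 1 y})"
      if "min 1 y \<le> x" "x \<le> max 1 y" for x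
      using that assms
      by (auto intro!: derivative_eq_intros simp flip: has_real_derivative_iff_has_vector_derivative)
  qed
  then show ?thesis by (simp add: ell_star_def)
qed

lemma slowly_varying_one: "slowly_varying (\<lambda>_. 1)"
  by (auto simp: slowly_varying_def set_borel_measurable_def)

section \<open>A single Pareto variable, and the reciprocal of a uniform one\<close>

context prob_space
begin

context
  fixes X :: "'a \<Rightarrow> real"
  assumes X[measurable]: "X \<in> borel_measurable M"
    and tail: "\<And>x. 1 < x \<Longrightarrow> prob {\<omega> \<in> space M. x < X \<omega>} = 1 / x"
begin

lemma pareto_prob_gt_1: "prob {\<omega> \<in> space M. 1 < X \<omega>} = 1"
proof (rule ccontr)
  define p where "p = prob {\<omega> \<in> space M. 1 < X \<omega>}"
  assume "prob {\<omega> \<in> space M. 1 < X \<omega>} \<noteq> 1"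
  then have p: "p < 1" "0 \<le> p" by (simp_all add: p_def less_le)
  \<comment> \<open>\<open>1 / x\<close> is the midpoint of \<open>p\<close> and 1; the tail at this
    \<open>x > 1\<close> would then exceed \<open>p\<close>.\<close>
  define x where "x = 2 / (1 + p)"
  have x: "1 < x" using p by (simp add: x_def field_simps)
  have "prob {\<omega> \<in> space M. x < X \<omega>} \<le> p"
    unfolding p_def using x by (intro finite_measure_mono) auto
  then have "(1 + p) / 2 \<le> p" using tail[OF x] by (simp add: x_def)
  then show False using p by simp
qed

lemma pareto_AE_gt_1: "AE \<omega> in M. 1 < X \<omega>"
proof -
  have "{\<omega> \<in> space M. 1 < X \<omega>} \<in> events" by measurable
  from prob_eq_1[OF this] pareto_prob_gt_1 show ?thesis by (auto elim: eventually_mono)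
qed

lemma pareto_survival:
  assumes x: "1 \<le> x" shows "survival X x = 1 / x"
proof (rule antisym)
  show "1 / x \<le> survival X x"
  proof -
    have "prob {\<omega> \<in> space M. x < X \<omega>} \<le> survival X x"
      unfolding survival_def by (intro finite_measure_mono) auto
    moreover have "prob {\<omega> \<in> space M. x < X \<omega>} = 1 / x"
      using x tail[of x] pareto_prob_gt_1 by (cases "x = 1") auto
    ultimately show ?thesis by simp
  qed
  show "survival X x \<le> 1 / x"
  proof (cases "x = 1")
    case False
    show ?thesis
    proof (rule dense_ge)
      fix p :: real assume p: "1 / x < p"
      \<comment> \<open>The closed tail is approached through open tails at \<open>y < x\<close>:
        \<open>1 / p\<close> makes \<open>1 / y <= p\<close>, and the midpoint of 1 and
        \<open>x\<close> keeps \<open>y\<close> above 1.\<close>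
      define y where "y = max (1 / p) ((1 + x) / 2)"
      have p0: "0 < p" using p x by (meson less_trans zero_less_divide_1_iff less_le_trans zero_less_one)
      have "1 < (1 + x) / 2" "1 / p < x" using p p0 x False by (simp_all add: field_simps)
      then have y: "1 < y" "y < x" "1 / p \<le> y" using x False by (auto simp: y_def less_max_iff_disj)
      have "survival X x \<le> prob {\<omega> \<in> space M. y < X \<omega>}"
        unfolding survival_def using y by (intro finite_measure_mono) auto
      also have "\<dots> = 1 / y" by (rule tail[OF y(1)])
      also have "\<dots> \<le> p" using y p0 by (simp add: field_simps)
      finally show "survival X x \<le> p" .
    qed
  qed (simp add: survival_def)
qed

lemma pareto_cdf: "cdf (distr M borel X) x = (if 1 \<le> x then 1 - 1 / x else 0)"
proof -
  have "cdf (distr M borel X) x = prob (space M - {\<omega> \<in> space M. x < X \<omega>})"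
    unfolding cdf_def by (subst measure_distr) (auto intro!: arg_cong[where f=prob])
  also have "\<dots> = 1 - prob {\<omega> \<in> space M. x < X \<omega>}" by (rule prob_compl) measurable
  finally have eq: "cdf (distr M borel X) x = 1 - prob {\<omega> \<in> space M. x < X \<omega>}" .
  consider "1 < x" | "x = 1" | "x < 1" by linarith
  then show ?thesis
  proof cases
    case 3
    have "prob {\<omega> \<in> space M. 1 < X \<omega>} \<le> prob {\<omega> \<in> space M. x < X \<omega>}"
      using 3 by (intro finite_measure_mono) auto
    then show ?thesis
      using eq 3 prob_le_1[of "{\<omega> \<in> space M. x < X \<omega>}"] by (simp add: pareto_prob_gt_1)
  qed (use eq tail pareto_prob_gt_1 in auto)
qed

lemma pareto_mean_infinite: "(\<integral>\<^sup>+ \<omega>. ennreal (X \<omega>) \<partial>M) = \<infinity>"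
proof (rule ccontr)
  assume "(\<integral>\<^sup>+ \<omega>. ennreal (X \<omega>) \<partial>M) \<noteq> \<infinity>"
  then obtain B where B: "0 \<le> B" "(\<integral>\<^sup>+ \<omega>. ennreal (X \<omega>) \<partial>M) = ennreal B"
    by (cases "\<integral>\<^sup>+ \<omega>. ennreal (X \<omega>) \<partial>M") auto
  have pos: "AE \<omega> in M. 0 < X \<omega>" using pareto_AE_gt_1 by eventually_elim simp
  \<comment> \<open>Then \<open>ln y = B + 1\<close>, while a mean \<open>B\<close> would bound
    every truncated mean by \<open>B\<close>.\<close>
  define y where "y = exp (B + 1)"
  have y: "1 \<le> y" using B by (simp add: y_def)
  have "ln y = truncated_mean X y - truncated_mean X 1"
    using ell_star_eq_truncated_mean[OF X pos, of "\<lambda>_. 1"] pareto_survival y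
    by (simp add: ell_star_one inverse_eq_divide)
  moreover have "0 \<le> truncated_mean X 1"
    using truncated_mean_ge[OF X pos, of 1] by (simp add: pareto_survival)
  moreover have "truncated_mean X y \<le> B"
  proof -
    have "ennreal (truncated_mean X y) = (\<integral>\<^sup>+ \<omega>. ennreal (min (X \<omega>) y) \<partial>M)"
      unfolding truncated_mean_def using y pos
      by (intro nn_integral_eq_integral[symmetric] integrable_min X pos) (auto elim: eventually_mono)
    also have "\<dots> \<le> ennreal B" unfolding B(2)[symmetric] by (intro nn_integral_mono ennreal_leI) simp
    finally show ?thesis using B by simp
  qed
  ultimately show False by (simp add: y_def)
qed

lemma pareto_quantile:
  assumes "1 \<le> n"
  shows "1 / (1 - cdf (distr M borel X) (real n)) = real n"
    and "is_quantile (distr M borel X) (1 - 1 / real n) (real n)"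
proof -
  show *: "1 / (1 - cdf (distr M borel X) (real n)) = real n"
    using assms by (simp add: pareto_cdf)
  show "is_quantile (distr M borel X) (1 - 1 / real n) (real n)"
    by (rule is_quantile_if_tail_eq[OF _ assms *]) (rule real_distribution_distr[OF X])
qed

end

lemma uniform_inverse_tail:
  assumes U[measurable]: "U \<in> borel_measurable M"
    and unif: "distr M borel U = uniform_measure lborel {0<..<1}" and x: "1 < x"
  shows "prob {\<omega> \<in> space M. x < 1 / U \<omega>} = 1 / (x::real)"
proof -
  have "prob {\<omega> \<in> space M. x < 1 / U \<omega>} = measure (distr M borel U) {u. x < 1 / u}"
    by (subst measure_distr) (auto intro!: arg_cong[where f=prob])
  also have "{u. x < 1 / u} = {0<..<1 / x}"
  proof (intro set_eqI)
    fix u :: real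
    show "u \<in> {u. x < 1 / u} \<longleftrightarrow> u \<in> {0<..<1 / x}"
    proof (cases "0 < u")
      case False
      \<comment> \<open>This includes \<open>u = 0\<close>, where \<open>1 / u\<close> is 0 by
        convention.\<close>
      then have "1 / u \<le> 0" by (simp add: divide_nonneg_nonpos)
      then have "\<not> x < 1 / u" using x by linarith
      then show ?thesis using False by simp
    qed (use x in \<open>auto simp: field_simps\<close>)
  qed
  also have "measure (distr M borel U) {0<..<1 / x} = 1 / x"
  proof -
    have "{0<..<1} \<inter> {0<..<1 / x} = {0<..<1 / x}" using x by (auto simp: field_simps)
    then show ?thesis using x unfolding unif by (simp add: measure_def emeasure_uniform_measure divide_ennreal_def)
  qed
  finally show ?thesis .
qed

end

section \<open>Sums of independent Pareto variables\<close>

context prob_space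
begin

context
  fixes X :: "nat \<Rightarrow> 'a \<Rightarrow> real"
  assumes iid: "iid_seq M X"
    and tail: "\<And>x. 1 < x \<Longrightarrow> prob {\<omega> \<in> space M. x < X 1 \<omega>} = 1 / x"
begin

lemma pareto_iid_measurable: "X 1 \<in> borel_measurable M"
  by (rule iid_seq_measurable[OF prob_space_axioms iid order_refl])

lemma pareto_iid_AE_gt_1: "AE \<omega> in M. 1 < X 1 \<omega>"
  by (rule pareto_AE_gt_1[OF pareto_iid_measurable]) (rule tail)

lemma pareto_iid_AE_pos: "1 \<le> i \<Longrightarrow> AE \<omega> in M. 0 < X i \<omega>"
proof (rule iid_seq_AE[OF prob_space_axioms iid])
  show "AE \<omega> in M. 0 < X 1 \<omega>"
    using pareto_iid_AE_gt_1 by eventually_elim simp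
qed auto

lemma pareto_iid_finite_inverse_moment: "finite_inverse_moment M X"
proof (rule finite_inverse_moment_if_ge_1)
  show "AE \<omega> in M. 1 \<le> X 1 \<omega>"
    using pareto_iid_AE_gt_1 by eventually_elim simp
qed (fact prob_space_axioms pareto_iid_measurable)+

text \<open>By \<open>pareto_cdf\<close> the tail above 1 determines the whole distribution
  function, hence the law of one term, hence that of the sums.\<close>

lemma pareto_iid_distr_eq:
  assumes N: "prob_space N" and Y: "iid_seq N Y"
    and tailY: "\<And>x. 1 < x \<Longrightarrow> measure N {\<omega> \<in> space N. x < Y 1 \<omega>} = 1 / x"
  shows "distr M borel (partial_sum X n) = distr N borel (partial_sum Y n)"
proof (rule iid_seq_partial_sum_distr_eq[OF prob_space_axioms iid N Y])
  have Y1: "Y 1 \<in> borel_measurable N" by (rule iid_seq_measurable[OF N Y order_refl])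
  show "distr M borel (X 1) = distr N borel (Y 1)"
  proof (rule cdf_unique)
    show "cdf (distr M borel (X 1)) = cdf (distr N borel (Y 1))"
      by (simp only: fun_eq_iff pareto_cdf[OF pareto_iid_measurable tail]
          prob_space.pareto_cdf[OF N Y1 tailY] simp_thms)
  qed (rule real_distribution_distr[OF pareto_iid_measurable]
      prob_space.real_distribution_distr[OF N Y1])+
qed

theorem pareto_inverse_moment_tendsto:
  "(\<lambda>n. ln (real n) * (\<integral>\<omega>. real n / partial_sum X n \<omega> \<partial>M)) \<longlonglongrightarrow> 1"
proof -
  note X = pareto_iid_measurable
  have "(\<lambda>n. \<integral>\<omega>. inverse (partial_sum X n \<omega> / real n * (1 / ell_star (\<lambda>_. 1) (real n))) \<partial>M) \<longlonglongrightarrow> 1"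
  proof (rule inverse_moment_partial_sum_tendsto[OF iid pareto_iid_AE_pos])
    show "survival (X 1) x = inverse x * 1" if "1 \<le> x" for x
      using pareto_survival[OF X tail that] by (simp add: inverse_eq_divide)
  qed (use slowly_varying_one pareto_mean_infinite[OF X tail] pareto_iid_finite_inverse_moment
      pareto_quantile(2)[OF X tail] in auto)
  then show ?thesis
  proof (rule Lim_transform_eventually)
    show "eventually (\<lambda>n. (\<integral>\<omega>. inverse (partial_sum X n \<omega> / real n * (1 / ell_star (\<lambda>_. 1) (real n))) \<partial>M)
        = ln (real n) * (\<integral>\<omega>. real n / partial_sum X n \<omega> \<partial>M)) sequentially"
      using eventually_ge_at_top[of 1]
    proof eventually_elim
      case (elim n)
      have "inverse (partial_sum X n \<omega> / real n * (1 / ell_star (\<lambda>_. 1) (real n)))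
          = ln (real n) * (real n / partial_sum X n \<omega>)" for \<omega>
        using elim by (simp add: ell_star_one divide_inverse mult_ac)
      then show ?case by (simp only: integral_mult_right_zero)
    qed
  qed
qed

end

lemma reciprocal_uniform_iid:
  assumes "iid_seq M U" and "distr M borel (U 1) = uniform_measure lborel {0<..<1}"
  shows "iid_seq M (\<lambda>i \<omega>. 1 / U i \<omega>)"
    and "1 < x \<Longrightarrow> prob {\<omega> \<in> space M. x < 1 / U 1 \<omega>} = 1 / x"
proof -
  show "iid_seq M (\<lambda>i \<omega>. 1 / U i \<omega>)"
    by (rule iid_seq_compose[OF prob_space_axioms assms(1), of "\<lambda>x. 1 / x"]) measurable
  show "1 < x \<Longrightarrow> prob {\<omega> \<in> space M. x < 1 / U 1 \<omega>} = 1 / x"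
    by (rule uniform_inverse_tail[OF iid_seq_measurable[OF prob_space_axioms assms(1) order_refl] assms(2)])
qed

end

text \<open>The middle conjunct starts from the Pareto tail of an iid sequence and derives the
  remaining hypotheses of the first conjunct for \<open>L = 1\<close> and \<open>b n = n\<close>,
  which makes the special case a genuine instance; the last conjunct is the resulting limit for
  uniform variables.\<close>

theorem mainTheorem3:
  fixes M :: "'a measure" and \<Delta> :: "nat \<Rightarrow> 'a \<Rightarrow> real"
    and L :: "real \<Rightarrow> real" and b :: "nat \<Rightarrow> real"
    and N :: "'b measure" and U :: "nat \<Rightarrow> 'b \<Rightarrow> real"
  shows
   "(prob_space M \<and> iid_seq M \<Delta> \<and> (\<forall>i\<ge>1. AE \<omega> in M. \<Delta> i \<omega> > 0)
      \<and> (\<forall>x\<ge>1. measure M {\<omega> \<in> space M. \<Delta> 1 \<omega> \<ge> x} = inverse x * L x)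
      \<and> slowly_varying L
      \<and> (\<integral>\<^sup>+ \<omega>. ennreal (\<Delta> 1 \<omega>) \<partial>M) = \<infinity>
      \<and> finite_inverse_moment M \<Delta>
      \<and> (\<forall>n\<ge>1. is_quantile (distr M borel (\<Delta> 1)) (1 - 1 / real n) (b n))
     \<longrightarrow> (\<lambda>n. \<integral>\<omega>. inverse (partial_sum \<Delta> n \<omega> / b n * (L (b n) / ell_star L (b n))) \<partial>M)
           \<longlonglongrightarrow> 1)
    \<and>
    (prob_space M \<and> iid_seq M \<Delta>
      \<and> (\<forall>x>1. measure M {\<omega> \<in> space M. \<Delta> 1 \<omega> > x} = 1 / x)
     \<longrightarrow> (\<forall>i\<ge>1. AE \<omega> in M. \<Delta> i \<omega> > 0)
       \<and> (\<forall>x\<ge>1. measure M {\<omega> \<in> space M. \<Delta> 1 \<omega> \<ge> x} = inverse x * 1)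
       \<and> slowly_varying (\<lambda>_. 1)
       \<and> (\<integral>\<^sup>+ \<omega>. ennreal (\<Delta> 1 \<omega>) \<partial>M) = \<infinity>
       \<and> finite_inverse_moment M \<Delta>
       \<and> (\<forall>n\<ge>1. is_quantile (distr M borel (\<Delta> 1)) (1 - 1 / real n) (real n)
                \<and> 1 / (1 - cdf (distr M borel (\<Delta> 1)) (real n)) = real n)
       \<and> (\<forall>n\<ge>1. ell_star (\<lambda>_. 1) (real n) = ln (real n))
       \<and> (prob_space N \<and> iid_seq N U
            \<and> distr N borel (U 1) = uniform_measure lborel {0<..<1}
          \<longrightarrow> (\<forall>n. distr M borel (partial_sum \<Delta> n)
                   = distr N borel (\<lambda>\<omega>. \<Sum>i=1..n. 1 / U i \<omega>))))
    \<and>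
    (prob_space N \<and> iid_seq N U
      \<and> distr N borel (U 1) = uniform_measure lborel {0<..<1}
     \<longrightarrow> (\<lambda>n. ln (real n) * (\<integral>\<omega>. real n / (\<Sum>i=1..n. 1 / U i \<omega>) \<partial>N)) \<longlonglongrightarrow> 1)"
proof (intro conjI impI, goal_cases)
  case 1
  then interpret prob_space M by blast
  show ?case
    by (rule inverse_moment_partial_sum_tendsto) (use 1 in \<open>auto simp only: survival_def\<close>)
next
  case 2
  then interpret prob_space M by blast
  show ?case using 2 pareto_iid_AE_pos[of \<Delta>] by blast
next
  case 3
  then interpret prob_space M by blast
  have "\<Delta> 1 \<in> borel_measurable M" using 3 by (intro pareto_iid_measurable) auto
  from pareto_survival[OF this] show ?case
    using 3 by (simp add: survival_def inverse_eq_divide)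
next
  case 4
  show ?case by (rule slowly_varying_one)
next
  case 5
  then interpret prob_space M by blast
  have "\<Delta> 1 \<in> borel_measurable M" using 5 by (intro pareto_iid_measurable) auto
  from pareto_mean_infinite[OF this] show ?case using 5 by blast
next
  case 6
  then interpret prob_space M by blast
  show ?case using 6 by (intro pareto_iid_finite_inverse_moment) auto
next
  case 7
  then interpret prob_space M by blast
  have "\<Delta> 1 \<in> borel_measurable M" using 7 by (intro pareto_iid_measurable) auto
  from pareto_quantile[OF this] show ?case using 7 by blast
next
  case 8
  show ?case by (simp add: ell_star_one)
next
  case 9
  then interpret M: prob_space M by blast
  interpret N: prob_space N using 9 by blast
  have U: "iid_seq N U" "distr N borel (U 1) = uniform_measure lborel {0<..<1}"
    using 9 by blast+
  note Y = N.reciprocal_uniform_iid[OF U]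
  have "distr M borel (partial_sum \<Delta> n) = distr N borel (partial_sum (\<lambda>i \<omega>. 1 / U i \<omega>) n)" for n
    using 9 by (intro M.pareto_iid_distr_eq[OF _ _ N.prob_space_axioms Y]) auto
  then show ?case by (simp add: partial_sum_def[abs_def])
next
  case 10
  then interpret N: prob_space N by blast
  have U: "iid_seq N U" "distr N borel (U 1) = uniform_measure lborel {0<..<1}"
    using 10 by blast+
  from N.pareto_inverse_moment_tendsto[OF N.reciprocal_uniform_iid[OF U]]
  show ?case by (simp only: partial_sum_def)
qed

end
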